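(* Let $f$ be a quasimodular form of weight $w$ and depth $r$ given by $f=\sum_{\ell=0}^rE_2^\ell h_\ell$, where $h_\ell$ ($\ell=0,\ldots,r$) are modular forms of weight $w-2\ell$. For $\ell=0,\dots,r$ let $$\binom r\ell g_\ell(z)=\left(\frac6{\pi i}\right)^\ell\sum_{m=0}^{r-\ell}\binom{\ell+m}{m}E_2(z)^mh_{\ell+m}(z).$$ Assume that the functions $g_\ell$ have vanishing orders $\lambda_\ell<\dim\mathcal{QM}_{w-2\ell}^{r-\ell}$ ($\ell=0,\ldots,r$) with $\lambda_0\ge\lambda_1\ge\cdots\ge\lambda_r\ge0$, i.e. $$g_\ell(z)=q^{\lambda_\ell}\sum_{n=0}^\infty a_\ell(n)q^n,\qquad a_\ell(0)\neq0.$$ Then $$\lambda_0+\cdots+\lambda_r\le\frac{w(r+1)}{12}.$$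
   Context: $\mathcal{M}_k$ denotes the space of holomorphic modular forms of weight $k$ for $\mathrm{PSL}(2,\mathbb{Z})$ (holomorphic also at $i\infty$); $q=e^{2\pi iz}$; $E_2=1-24\sum_{n\ge1}\sigma_1(n)q^n$. Quasimodular forms of weight $w$ and depth $\le r$ are the elements of $\mathcal{QM}_w^r=\bigoplus_{\ell=0}^rE_2^\ell\mathcal{M}_{w-2\ell}$; depth $r$ means $h_r\neq0$. *)

theory Defs
  imports "HOL-Complex_Analysis.Complex_Analysis" "HOL-Library.Function_Algebras"
begin

definition upper_half_plane :: "complex set" where
  "upper_half_plane = {z. Im z > 0}"

definition q_param :: "complex \<Rightarrow> complex" where
  "q_param z = exp (2 * of_real pi * \<i> * z)"

definition has_q_expansion :: "(complex \<Rightarrow> complex) \<Rightarrow> (nat \<Rightarrow> complex) \<Rightarrow> bool" where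
  "has_q_expansion f c \<longleftrightarrow>
     (\<forall>z\<in>upper_half_plane. (\<lambda>n. c n * q_param z ^ n) sums f z)"

text \<open>
  Functions on the upper half plane are represented by total functions that vanish elsewhere;
  this makes equality, and hence linear independence, of functions on the half plane agree with
  the HOL notions. Holomorphy at the cusp is the existence of a \<open>q\<close>-expansion without negative
  exponents. The matrix \<open>-I\<close> forces the space to be zero for odd weights.
\<close>
definition modular_forms :: "int \<Rightarrow> (complex \<Rightarrow> complex) set" where
  "modular_forms k = {f.
     f holomorphic_on upper_half_plane \<and>
     (\<forall>z. z \<notin> upper_half_plane \<longrightarrow> f z = 0) \<and>
     (\<forall>a b c d :: int. a * d - b * c = 1 \<longrightarrow>
        (\<forall>z\<in>upper_half_plane.
           f ((of_int a * z + of_int b) / (of_int c * z + of_int d)) =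
             (of_int c * z + of_int d) powi k * f z)) \<and>
     (\<exists>c. has_q_expansion f c)}"

definition sigma1 :: "nat \<Rightarrow> nat" where
  "sigma1 n = (\<Sum>d | d dvd n. d)"

text \<open>Only the values of \<open>E2\<close> on the upper half plane are meaningful.\<close>
definition E2 :: "complex \<Rightarrow> complex" where
  "E2 z = 1 - 24 * (\<Sum>n. of_nat (sigma1 (Suc n)) * q_param z ^ Suc n)"

definition quasimodular_forms :: "int \<Rightarrow> nat \<Rightarrow> (complex \<Rightarrow> complex) set" where
  "quasimodular_forms w r =
     {(\<lambda>z. \<Sum>l\<le>r. E2 z ^ l * h l z) | h.
        \<forall>l\<le>r. h l \<in> modular_forms (w - 2 * int l)}"

definition fun_scale :: "complex \<Rightarrow> (complex \<Rightarrow> complex) \<Rightarrow> complex \<Rightarrow> complex" where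
  "fun_scale c f = (\<lambda>z. c * f z)"

interpretation complex_fun: vector_space fun_scale
  by unfold_locales (auto simp: fun_scale_def fun_eq_iff algebra_simps)

lemma modular_forms_subspace: "complex_fun.subspace (modular_forms k)"
proof (rule complex_fun.subspaceI)
  show "0 \<in> modular_forms k"
    by (auto simp: modular_forms_def has_q_expansion_def zero_fun_def intro!: exI[of _ "\<lambda>_. 0"])
next
  fix f g assume "f \<in> modular_forms k" "g \<in> modular_forms k"
  moreover from this obtain a b where "has_q_expansion f a" "has_q_expansion g b"
    by (auto simp: modular_forms_def)
  hence "has_q_expansion (\<lambda>z. f z + g z) (\<lambda>n. a n + b n)"
    by (auto simp: has_q_expansion_def ring_distribs intro: sums_add)
  ultimately show "f + g \<in> modular_forms k"
    by (auto simp: modular_forms_def plus_fun_def ring_distribs intro!: holomorphic_intros)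
next
  fix c f assume "f \<in> modular_forms k"
  moreover from this obtain a where "has_q_expansion f a"
    by (auto simp: modular_forms_def)
  hence "has_q_expansion (\<lambda>z. c * f z) (\<lambda>n. c * a n)"
    by (auto simp: has_q_expansion_def mult.assoc intro: sums_mult)
  ultimately show "fun_scale c f \<in> modular_forms k"
    by (auto simp: modular_forms_def fun_scale_def intro!: holomorphic_intros)
qed

lemma quasimodular_forms_subspace: "complex_fun.subspace (quasimodular_forms w r)"
proof (rule complex_fun.subspaceI)
  have "0 \<in> modular_forms k" for k
    using modular_forms_subspace complex_fun.subspace_0 by blast
  thus "0 \<in> quasimodular_forms w r"
    unfolding quasimodular_forms_def
    by (intro CollectI exI[of _ "\<lambda>_. 0"]) (auto simp: zero_fun_def)
next
  fix f g assume "f \<in> quasimodular_forms w r" "g \<in> quasimodular_forms w r"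
  then obtain h k where
    "f = (\<lambda>z. \<Sum>l\<le>r. E2 z ^ l * h l z)" "\<forall>l\<le>r. h l \<in> modular_forms (w - 2 * int l)"
    "g = (\<lambda>z. \<Sum>l\<le>r. E2 z ^ l * k l z)" "\<forall>l\<le>r. k l \<in> modular_forms (w - 2 * int l)"
    by (auto simp: quasimodular_forms_def)
  thus "f + g \<in> quasimodular_forms w r"
    unfolding quasimodular_forms_def
    by (intro CollectI exI[of _ "\<lambda>l. h l + k l"])
       (auto simp: plus_fun_def ring_distribs sum.distrib
             intro: complex_fun.subspace_add[OF modular_forms_subspace, unfolded plus_fun_def])
next
  fix c f assume "f \<in> quasimodular_forms w r"
  then obtain h where
    "f = (\<lambda>z. \<Sum>l\<le>r. E2 z ^ l * h l z)" "\<forall>l\<le>r. h l \<in> modular_forms (w - 2 * int l)"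
    by (auto simp: quasimodular_forms_def)
  thus "fun_scale c f \<in> quasimodular_forms w r"
    unfolding quasimodular_forms_def
    by (intro CollectI exI[of _ "\<lambda>l. fun_scale c (h l)"])
       (auto simp: fun_scale_def sum_distrib_left mult_ac
             intro: complex_fun.subspace_scale[OF modular_forms_subspace, unfolded fun_scale_def])
qed

end

theory Submission
  imports Defs "HOL-Real_Asymp.Real_Asymp" "Jordan_Normal_Form.Determinant"
begin

text \<open>
  Up to a binomial factor, \<open>g\<^sub>l\<close> is the coefficient of \<open>z ^ (w - l)\<close> in \<open>f (-1/z)\<close>, so the
  span of \<open>f\<^sub>k = \<Sum>l\<le>k. (k choose l) * z ^ (k - l) * g\<^sub>l\<close> for \<open>k = 0, \<dots>, r\<close> is stable under the modular group in
  weight \<open>w - r\<close>. The Wronskian of the \<open>f\<^sub>k\<close> is therefore modular of weight \<open>w (r + 1)\<close>. It is a determinant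
  in the \<open>g\<^sub>l\<close> and their derivatives whose \<open>l\<close>-th row is divisible by \<open>q\<close> to the power \<open>\<lambda>\<^sub>l\<close>, and as the
  \<open>\<lambda>\<^sub>l\<close> decrease, its leading coefficient is a confluent Vandermonde determinant and does not vanish. Hence it
  vanishes to order exactly \<open>\<Sum>\<lambda>\<^sub>l\<close> at the cusp, which is at most a twelfth of its weight: dividing by a
  power of the discriminant would otherwise give a form of negative weight, against the maximum principle.
\<close>

section \<open>Partial fractions\<close>

text \<open>The \<open>f\<^sub>k\<close> carry powers of z and have no q-expansion, so the order at
  the cusp has to be read off from the \<open>g\<^sub>l\<close>. Let N be the operator sending the
  vector (g_k) to (k g_(k-1)). Since (k choose l) (k - l) = (k choose l+1) (l + 1), differentiating
  \<open>f\<^sub>k\<close> replaces each g_l by g_l' + l g_(l-1). Iterating d/dz + N on the vector g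
  therefore gives the Wronskian matrix up to a unitriangular factor, with all powers of z gone. The
  same N keeps the leading determinant nonzero when some of the exponents coincide. Invariance under
  z -> z + 1 is contained in being a function of q, so only z -> -1/z needs work. There d/dz + N is
  compatible with the triangular transformation matrix S because z^2 S' = z^2 S N - N S. The only
  analytic input is E2(-1/z) = z^2 E2(z) + 6 z / (pi i). It yields the transformation of the g_l,
  whose normalising constant is this 6 / (pi i), and that of the discriminant. The obstacle is that
  the double series for E2 converges only conditionally.\<close>

lemma Digamma_reflection:
  fixes z :: complex
  assumes z: "z \<notin> \<int>"
  shows "Digamma (1 - z) - Digamma z = of_real pi * cot (of_real pi * z)"
proof -
  have z1: "1 - z \<notin> \<int>"
    using z Ints_diff[of 1 "1 - z"] by auto
  have nz: "z \<notin> \<int>\<^sub>\<le>\<^sub>0" "1 - z \<notin> \<int>\<^sub>\<le>\<^sub>0"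
    using z z1 nonpos_Ints_subset_Ints by blast+
  have s: "sin (of_real pi * z) \<noteq> 0"
    using z by (subst mult.commute, subst sin_eq_0) (auto simp: mult.commute Ints_def)
  have "((\<lambda>z. Gamma z * Gamma (1 - z)) has_field_derivative
          Gamma z * Gamma (1 - z) * (Digamma z - Digamma (1 - z))) (at z)"
    using nz by (auto intro!: derivative_eq_intros simp: algebra_simps)
  moreover have "((\<lambda>z. of_real pi / sin (of_real pi * z)) has_field_derivative
          - (of_real pi)\<^sup>2 * cos (of_real pi * z) / sin (of_real pi * z) ^ 2) (at z)"
    using s by (auto intro!: derivative_eq_intros simp: power2_eq_square)
  \<comment> \<open>The reflection formula for Gamma equates the two differentiated functions;
    dividing by that product gives its logarithmic derivative.\<close>
  ultimately have "Gamma z * Gamma (1 - z) * (Digamma z - Digamma (1 - z)) =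
      - (of_real pi)\<^sup>2 * cos (of_real pi * z) / sin (of_real pi * z) ^ 2"
    by (simp only: Gamma_reflection_complex) (rule DERIV_unique)
  hence "(of_real pi * sin (of_real pi * z)) * ((Digamma (1 - z) - Digamma z) * sin (of_real pi * z)
           - of_real pi * cos (of_real pi * z)) = 0"
    using s by (simp add: Gamma_reflection_complex power2_eq_square field_simps)
  hence "(Digamma (1 - z) - Digamma z) * sin (of_real pi * z) = of_real pi * cos (of_real pi * z)"
    using s by simp
  thus ?thesis using s by (simp add: cot_def nonzero_eq_divide_eq)
qed

text \<open>Derivative of \<open>Digamma_reflection\<close>, which holds on a whole neighbourhood of
  \<open>z\<close> because the integers form a closed set.\<close>

lemma Trigamma_reflection:
  fixes z :: complex
  assumes z: "z \<notin> \<int>"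
  shows "Polygamma 1 z + Polygamma 1 (1 - z) = (of_real pi / sin (of_real pi * z)) ^ 2"
proof -
  have z1: "1 - z \<notin> \<int>"
    using z Ints_diff[of 1 "1 - z"] by auto
  have nz: "z \<notin> \<int>\<^sub>\<le>\<^sub>0" "1 - z \<notin> \<int>\<^sub>\<le>\<^sub>0"
    using z z1 nonpos_Ints_subset_Ints by blast+
  have s: "sin (of_real pi * z) \<noteq> 0"
    using z by (subst mult.commute, subst sin_eq_0) (auto simp: mult.commute Ints_def)
  have "eventually (\<lambda>z. z \<notin> (\<int> :: complex set)) (nhds z)"
    using z by (intro eventually_nhds_in_open[of "- \<int>", simplified]) (auto simp: open_Compl)
  hence "eventually (\<lambda>z. Digamma (1 - z) - Digamma z = of_real pi * cot (of_real pi * z)) (nhds z)"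
    by eventually_elim (rule Digamma_reflection)
  moreover have "((\<lambda>z. Digamma (1 - z) - Digamma z) has_field_derivative
          - Polygamma 1 (1 - z) - Polygamma 1 z) (at z)"
    using nz by (auto intro!: derivative_eq_intros simp: DERIV_chain2)
  ultimately have "((\<lambda>z. of_real pi * cot (of_real pi * z)) has_field_derivative
          - Polygamma 1 (1 - z) - Polygamma 1 z) (at z)"
    by (subst (asm) DERIV_cong_ev[OF refl _ refl])
  moreover have "((\<lambda>z. of_real pi * cot (of_real pi * z)) has_field_derivative
          - ((of_real pi / sin (of_real pi * z)) ^ 2)) (at z)"
    using s by (auto intro!: derivative_eq_intros DERIV_cot[THEN DERIV_chain2]
                     simp: power2_eq_square field_simps)
  ultimately show ?thesis
    using DERIV_unique by (fastforce simp: algebra_simps)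
qed

section \<open>Sums over all integers\<close>

lemma has_sum_diff:
  fixes f g :: "'a \<Rightarrow> 'b :: real_normed_vector"
  assumes "(f has_sum a) A" "(g has_sum b) A"
  shows "((\<lambda>x. f x - g x) has_sum (a - b)) A"
  using has_sum_add[OF assms(1), of "\<lambda>x. - g x" "- b"] assms(2) by (simp add: has_sum_uminus)

lemma has_sum_int:
  fixes f :: "int \<Rightarrow> 'a :: {topological_comm_monoid_add, t2_space}"
  assumes "((\<lambda>n. f (int n)) has_sum A) UNIV" "((\<lambda>n. f (- int (Suc n))) has_sum B) UNIV"
  shows "(f has_sum (A + B)) UNIV"
proof -
  have "(f has_sum A) {0..}"
    using assms(1) by (subst (asm) has_sum_reindex_bij_betw[of int UNIV "{0..}" f])
      (intro bij_betwI[of _ _ _ nat]; simp)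
  moreover have "(f has_sum B) {..<0}"
    using assms(2) by (subst (asm) has_sum_reindex_bij_betw[of "\<lambda>n. - int (Suc n)" UNIV "{..<0}" f])
      (intro bij_betwI[of _ _ _ "\<lambda>n. nat (- n) - 1"]; auto)
  ultimately have "(f has_sum (A + B)) ({0..} \<union> {..<0})"
    by (rule has_sum_Un_disjoint) auto
  also have "{0..} \<union> {..<0} = (UNIV :: int set)" by auto
  finally show ?thesis .
qed

text \<open>An unconditional sum can be evaluated along any exhausting sequence of finite sets. The
  half-open blocks pair n with -(n + 1), which is how the Digamma series at z and at 1 - z fit
  together, and they leave just two boundary terms when the summand telescopes.\<close>

lemma has_sum_int_LIMSEQ:
  fixes f :: "int \<Rightarrow> 'a :: {topological_comm_monoid_add, t2_space}"
  assumes "(f has_sum S) UNIV"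
  shows "(\<lambda>N. \<Sum>n\<in>{- int N..<int N}. f n) \<longlonglongrightarrow> S"
proof -
  have "filterlim (\<lambda>N. {- int N..<int N}) (finite_subsets_at_top UNIV) sequentially"
    unfolding filterlim_finite_subsets_at_top
  proof safe
    fix X :: "int set" assume X: "finite X"
    define N where "N = nat (Max (insert 0 (abs ` X))) + 1"
    have "\<bar>x\<bar> < int N" if "x \<in> X" for x
    proof -
      have "\<bar>x\<bar> \<le> Max (insert 0 (abs ` X))" using X that by (intro Max_ge) auto
      thus ?thesis unfolding N_def by linarith
    qed
    hence "\<forall>\<^sub>F n in sequentially. X \<subseteq> {- int n..<int n}"
      by (intro eventually_sequentiallyI[of N]) fastforce
    thus "\<forall>\<^sub>F x in sequentially. finite {- int x..<int x} \<and> X \<subseteq> {- int x..<int x} \<and> {- int x..<int x} \<subseteq> UNIV"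
      by simp
  qed
  with assms show ?thesis
    unfolding has_sum_def by (rule filterlim_compose)
qed

lemma sum_int_symmetric:
  fixes f :: "int \<Rightarrow> 'a :: comm_monoid_add"
  shows "(\<Sum>n\<in>{- int N..<int N}. f n) = (\<Sum>n<N. f (int n) + f (- int (Suc n)))"
proof (induction N)
  case (Suc N)
  have "{- int (Suc N)..<int (Suc N)} = insert (int N) (insert (- int (Suc N)) {- int N..<int N})"
    by auto
  thus ?case using Suc by (simp add: add_ac)
qed auto

lemma telescope_int:
  fixes f :: "int \<Rightarrow> 'a :: ab_group_add"
  shows "(\<Sum>n\<in>{- int N..<int N}. f n - f (n + 1)) = f (- int N) - f (int N)"
proof (induction N)
  case (Suc N)
  have "- int (Suc N) + 1 = - int N" "int N + 1 = int (Suc N)" by simp_all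
  thus ?case using Suc
    by (simp only: sum_int_symmetric sum.lessThan_Suc) (simp add: algebra_simps)
qed auto

text \<open>Difference of the limit formulas for Digamma at 1 - z and z, in which the logarithms
  cancel. The series converges only conditionally, hence a limit of block sums instead of
  \<open>has_sum\<close>.\<close>

lemma cot_partial_fractions:
  fixes z :: complex
  assumes z: "z \<notin> \<int>"
  shows "(\<lambda>N. \<Sum>n\<in>{- int N..<int N}. 1 / (z + of_int n)) \<longlonglongrightarrow> of_real pi * cot (of_real pi * z)"
proof -
  have nz: "z \<noteq> 0" "1 - z \<noteq> 0" using z by auto
  have "(\<lambda>m. (of_real (ln (real m)) - (\<Sum>n<m. inverse (1 - z + of_nat n))) -
             (of_real (ln (real m)) - (\<Sum>n<m. inverse (z + of_nat n))))
          \<longlonglongrightarrow> Digamma (1 - z) - Digamma z"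
    by (intro tendsto_diff Digamma_LIMSEQ nz)
  also have "(\<lambda>m. (of_real (ln (real m)) - (\<Sum>n<m. inverse (1 - z + of_nat n))) -
             (of_real (ln (real m)) - (\<Sum>n<m. inverse (z + of_nat n)))) =
          (\<lambda>m. \<Sum>n<m. inverse (z + of_nat n) - inverse (1 - z + of_nat n))"
    by (simp add: sum_subtractf)
  also have "\<dots> = (\<lambda>m. \<Sum>n<m. 1 / (z + of_int (int n)) + 1 / (z + of_int (- int (Suc n))))"
  proof (intro ext sum.cong refl)
    fix n :: nat
    have "1 / (z + of_int (- int (Suc n))) = 1 / - (1 - z + of_nat n)"
      by (simp add: algebra_simps)
    also have "\<dots> = - inverse (1 - z + of_nat n)"
      by (simp only: divide_minus_right inverse_eq_divide)
    finally show "inverse (z + of_nat n) - inverse (1 - z + of_nat n) =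
            1 / (z + of_int (int n)) + 1 / (z + of_int (- int (Suc n)))"
      by (simp add: inverse_eq_divide)
  qed
  finally show ?thesis
    by (simp only: Digamma_reflection[OF z] sum_int_symmetric)
qed

lemma Polygamma_1_has_sum:
  fixes z :: complex
  assumes "z \<noteq> 0"
  shows "((\<lambda>n. 1 / (z + of_nat n) ^ 2) has_sum Polygamma 1 z) UNIV"
proof -
  have "(\<lambda>n. 1 / (z + of_nat n) ^ 2) sums Polygamma 1 z"
    using Polygamma_LIMSEQ[of z 1] assms by (simp add: numeral_2_eq_2 inverse_eq_divide)
  moreover have "summable (\<lambda>n. norm (1 / (z + of_nat n) ^ 2))"
  proof (rule summable_comparison_test_ev)
    show "summable (\<lambda>n. 4 * inverse (real n ^ 2))"
      by (intro summable_mult inverse_power_summable) auto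
    show "eventually (\<lambda>n. norm (norm (1 / (z + of_nat n) ^ 2)) \<le> 4 * inverse (real n ^ 2)) sequentially"
      using eventually_ge_at_top[of "Suc (nat \<lceil>2 * norm z\<rceil>)"]
    proof eventually_elim
      case (elim n)
      have n: "real n \<ge> 2 * norm z" "n > 0" using elim by linarith+
      have "norm (z + of_nat n) \<ge> real n - norm z"
        using norm_diff_ineq[of "of_nat n :: complex" z] by (simp add: add_ac)
      with n have "norm (z + of_nat n) \<ge> real n / 2" by linarith
      hence "norm (z + of_nat n) ^ 2 \<ge> (real n / 2) ^ 2" by (intro power_mono) auto
      moreover have "(real n / 2) ^ 2 > 0" using n(2) by simp
      ultimately have "norm (z + of_nat n) ^ 2 > 0" "norm (z + of_nat n) ^ 2 \<ge> (real n / 2) ^ 2"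
        by linarith+
      thus ?case using n(2)
        by (simp add: norm_divide norm_power divide_simps)
    qed
  qed
  ultimately show ?thesis by (intro norm_summable_imp_has_sum)
qed

lemma sin_pi_partial_fractions:
  fixes z :: complex
  assumes z: "z \<notin> \<int>"
  shows "((\<lambda>n. 1 / (z + of_int n) ^ 2) has_sum (of_real pi / sin (of_real pi * z)) ^ 2) UNIV"
proof -
  have nz: "z \<noteq> 0" "1 - z \<noteq> 0" using z by auto
  have eq: "(z + of_int (- int (Suc n))) ^ 2 = (1 - z + of_nat n) ^ 2" for n
    by (simp add: power2_eq_square algebra_simps)
  have "((\<lambda>n. 1 / (z + of_int n) ^ 2) has_sum (Polygamma 1 z + Polygamma 1 (1 - z))) UNIV"
    by (rule has_sum_int) (use Polygamma_1_has_sum[OF nz(1)] Polygamma_1_has_sum[OF nz(2)] in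
        \<open>simp_all only: eq of_int_of_nat_eq\<close>)
  thus ?thesis by (simp only: Trigamma_reflection[OF z])
qed

text \<open>Twice the Basel series; the index 0 contributes 1 / 0 = 0.\<close>

lemma inverse_squares_has_sum_int:
  "((\<lambda>n. 1 / (of_int n :: complex) ^ 2) has_sum of_real (pi ^ 2 / 3)) UNIV"
proof -
  have "(\<lambda>n. 1 / real (n + 1) ^ 2) sums (pi ^ 2 / 6)"
    using inverse_squares_sums by simp
  hence 1: "((\<lambda>n. 1 / real (n + 1) ^ 2) has_sum (pi ^ 2 / 6)) UNIV"
    by (intro norm_summable_imp_has_sum) (auto simp: sums_iff)
  hence 2: "((\<lambda>n. 1 / real n ^ 2) has_sum (pi ^ 2 / 6)) (range Suc)"
    by (subst has_sum_reindex) (auto simp: o_def)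
  have 3: "((\<lambda>n. 1 / real n ^ 2) has_sum (pi ^ 2 / 6)) UNIV"
    using 2 by (rule iffD1[OF has_sum_cong_neutral, rotated -1])
      (auto simp: image_iff dest: gr0_implies_Suc, metis not0_implies_Suc)
  have "((\<lambda>n. 1 / real_of_int n ^ 2) has_sum (pi ^ 2 / 6 + pi ^ 2 / 6)) UNIV"
    by (rule has_sum_int) (use 1 3 in \<open>simp_all add: power2_eq_square algebra_simps\<close>)
  from has_sum_of_real[OF this, where 'a = complex] show ?thesis by simp
qed

section \<open>The transformation law of \<open>E2\<close>\<close>

text \<open>The imaginary part of m z + t controls m, and then the real part controls t. The
  arguments are real so that the bound also applies at the half-integral shifts in
  \<open>eis_corr\<close>.\<close>

lemma quadratic_form_lower_bound:
  assumes z: "Im z > 0"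
  obtains d :: real where "d > 0" "\<And>m t :: real. norm (of_real m * z + of_real t) ^ 2 \<ge> d * (m\<^sup>2 + t\<^sup>2)"
proof -
  define y where "y = Im z"
  define R where "R = (norm z)\<^sup>2 + y\<^sup>2 + 1"
  have y: "y > 0" and R: "R > 0" using z by (auto simp: R_def y_def add_nonneg_pos)
  define d where "d = y\<^sup>2 / (2 * R)"
  show thesis
  proof
    show "d > 0" using y R by (simp add: d_def)
    fix m t :: real
    define w where "w = of_real m * z + of_real t"
    have a: "m\<^sup>2 * y\<^sup>2 \<le> norm w ^ 2"
      using abs_Im_le_cmod[of w] power_mono[of "\<bar>Im w\<bar>" "norm w" 2]
      by (simp add: w_def y_def power_mult_distrib)
    have "t = Re (w - of_real m * z)" by (simp add: w_def)
    hence "\<bar>t\<bar> \<le> norm (w - of_real m * z)" using abs_Re_le_cmod by metis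
    also have "\<dots> \<le> norm w + \<bar>m\<bar> * norm z"
      using norm_triangle_ineq4[of w "of_real m * z"] by (simp add: norm_mult)
    finally have "\<bar>t\<bar> ^ 2 \<le> (norm w + \<bar>m\<bar> * norm z) ^ 2" by (intro power_mono) auto
    also have "\<dots> \<le> 2 * (norm w)\<^sup>2 + 2 * (m\<^sup>2 * (norm z)\<^sup>2)"
      using sum_squares_bound[of "norm w" "\<bar>m\<bar> * norm z"]
      by (simp add: power2_sum power_mult_distrib)
    finally have b: "t\<^sup>2 \<le> 2 * (norm w)\<^sup>2 + 2 * (m\<^sup>2 * (norm z)\<^sup>2)" by simp
    have "y\<^sup>2 * (m\<^sup>2 + t\<^sup>2) \<le> m\<^sup>2 * y\<^sup>2 + y\<^sup>2 * (2 * (norm w)\<^sup>2 + 2 * (m\<^sup>2 * (norm z)\<^sup>2))"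
      using mult_left_mono[OF b, of "y\<^sup>2"] by (simp add: algebra_simps)
    also have "\<dots> = m\<^sup>2 * y\<^sup>2 + 2 * y\<^sup>2 * (norm w)\<^sup>2 + 2 * (norm z)\<^sup>2 * (m\<^sup>2 * y\<^sup>2)"
      by (simp add: algebra_simps)
    also have "\<dots> \<le> (norm w)\<^sup>2 + 2 * y\<^sup>2 * (norm w)\<^sup>2 + 2 * (norm z)\<^sup>2 * (norm w)\<^sup>2"
      by (intro add_mono mult_left_mono a) auto
    also have "\<dots> \<le> 2 * R * (norm w)\<^sup>2"
      by (simp add: R_def algebra_simps)
    finally show "norm w ^ 2 \<ge> d * (m\<^sup>2 + t\<^sup>2)"
      using R by (simp add: d_def field_simps)
  qed
qed

lemma summable_on_inverse_Suc_squares_int: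
  "(\<lambda>n. 1 / (1 + real_of_int n ^ 2)) summable_on UNIV"
proof -
  have 0: "summable (\<lambda>n. 1 / (1 + real n ^ 2))"
  proof (rule summable_comparison_test_ev)
    show "summable (\<lambda>n. inverse (real n ^ 2))" by (intro inverse_power_summable) auto
    show "eventually (\<lambda>n. norm (1 / (1 + real n ^ 2)) \<le> inverse (real n ^ 2)) sequentially"
      using eventually_gt_at_top[of 0] by eventually_elim (simp add: divide_simps add_pos_nonneg)
  qed
  hence 1: "(\<lambda>n. 1 / (1 + real n ^ 2)) summable_on UNIV"
    by (intro norm_summable_imp_summable_on) auto
  have "summable (\<lambda>n. 1 / (1 + real (Suc n) ^ 2))"
    using 0 by (subst summable_Suc_iff)
  hence 2: "(\<lambda>n. 1 / (1 + real (Suc n) ^ 2)) summable_on UNIV"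
    by (intro norm_summable_imp_summable_on) auto
  have eq: "real_of_int (- int (Suc n)) ^ 2 = real (Suc n) ^ 2" for n
    by (simp add: power2_eq_square algebra_simps)
  show ?thesis
    using has_sum_int[of "\<lambda>n. 1 / (1 + real_of_int n ^ 2)"] 1 2
    unfolding summable_on_def eq of_int_of_nat_eq by blast
qed

text \<open>
  Subtracting \<open>eis_corr\<close>, a difference that telescopes in \<open>n\<close>, makes the double series of
  \<open>1 / (m z + n)\<^sup>2\<close> absolutely convergent. The half-integral shifts keep the denominators nonzero
  for all \<open>(m, n)\<close>, and the junk value \<open>1 / 0 = 0\<close> takes care of the main term at the origin.
\<close>
definition eis_corr :: "complex \<Rightarrow> complex" where
  "eis_corr w = 1 / (w - 1/2) - 1 / (w + 1/2)"

text \<open>With w = m z + n the term equals -1 / (4 w^2 (w^2 - 1/4)) away from the origin, so it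
  decays like the inverse fourth power of the length of (m, n). Since (1 + m^2) (1 + n^2) \<le> (1 +
  m^2 + n^2)^2, this is dominated by a product of two convergent single series.\<close>

lemma eis_summable:
  assumes z: "Im z > 0"
  shows "(\<lambda>(m, n). 1 / (of_int m * z + of_int n)\<^sup>2 - eis_corr (of_int m * z + of_int n))
           summable_on (UNIV :: (int \<times> int) set)"
proof -
  obtain d :: real where d: "d > 0"
    "\<And>m t :: real. norm (of_real m * z + of_real t) ^ 2 \<ge> d * (m\<^sup>2 + t\<^sup>2)"
    using quadratic_form_lower_bound[OF z] by blast
  \<comment> \<open>The summand 4 is for the origin, where the main term is 1 / 0 = 0 and
    \<open>eis_corr 0\<close> = -4; 4 / d^2 covers all other pairs.\<close>
  define K where "K = 4 + 4 / d\<^sup>2"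
  have K: "K \<ge> 0" using d by (simp add: K_def)
  have bound: "norm (1 / (of_int m * z + of_int n)\<^sup>2 - eis_corr (of_int m * z + of_int n)) \<le>
                 K * (1 / (1 + real_of_int m ^ 2) * (1 / (1 + real_of_int n ^ 2)))" for m n :: int
  proof (cases "m = 0 \<and> n = 0")
    case True
    thus ?thesis using d(1) by (simp add: eis_corr_def K_def)
  next
    case False
    define w where "w = of_int m * z + of_int n"
    define M where "M = real_of_int m ^ 2"
    define N where "N = real_of_int n ^ 2"
    have pos: "M \<ge> 0" "N \<ge> 0" by (auto simp: M_def N_def)
    have MN: "M + N \<ge> 1"
    proof -
      have "m\<^sup>2 + n\<^sup>2 \<noteq> 0" using False by (simp add: sum_power2_eq_zero_iff)
      hence "m\<^sup>2 + n\<^sup>2 \<ge> 1" using sum_power2_ge_zero[of m n] by linarith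
      hence "real_of_int (m\<^sup>2 + n\<^sup>2) \<ge> 1" by linarith
      thus ?thesis by (simp add: M_def N_def)
    qed
    \<comment> \<open>Integrality of \<open>n\<close> enters here: n + 1/2 and n - 1/2 stay at
      distance at least |n| / 2 from 0.\<close>
    have half: "(real_of_int n + s / 2) ^ 2 \<ge> N / 4" if "s = 1 \<or> s = -1" for s :: real
    proof -
      have "\<bar>real_of_int n\<bar> \<le> \<bar>2 * real_of_int n + s\<bar>"
      proof (cases "n = 0")
        case False
        hence "real_of_int n \<ge> 1 \<or> real_of_int n \<le> -1" by linarith
        with that show ?thesis by linarith
      qed auto
      hence "\<bar>real_of_int n\<bar> ^ 2 \<le> \<bar>2 * real_of_int n + s\<bar> ^ 2" by (intro power_mono) auto
      thus ?thesis by (simp add: N_def power2_eq_square field_simps)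
    qed
    have b0: "norm w ^ 2 \<ge> d * (M + N)"
      using d(2)[of m n] by (simp add: w_def M_def N_def)
    have b1: "norm (w + of_real (s / 2)) ^ 2 \<ge> d * (M + N) / 4" if "s = 1 \<or> s = -1" for s :: real
    proof -
      have "d * (M + N) / 4 \<le> d * (M + (real_of_int n + s / 2)\<^sup>2)"
        using half[OF that] pos d(1) mult_left_mono[of "(M + N) / 4" "M + (real_of_int n + s / 2)\<^sup>2" d]
        by simp
      also have "\<dots> \<le> norm (w + of_real (s / 2)) ^ 2"
        using d(2)[of m "real_of_int n + s / 2"] by (simp add: w_def M_def add_ac)
      finally show ?thesis .
    qed
    have b2: "norm (w - 1/2) ^ 2 \<ge> d * (M + N) / 4" "norm (w + 1/2) ^ 2 \<ge> d * (M + N) / 4"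
      using b1[of "-1"] b1[of 1] by simp_all
    define X where "X = norm w ^ 2 * (norm (w - 1/2) * norm (w + 1/2))"
    have "(d * (M + N) / 4) ^ 2 \<le> (norm (w - 1/2) * norm (w + 1/2)) ^ 2"
      unfolding power_mult_distrib unfolding power2_eq_square[of "d * (M + N) / 4"]
      using b2 d MN by (intro mult_mono) auto
    hence b3: "d * (M + N) / 4 \<le> norm (w - 1/2) * norm (w + 1/2)"
      by (rule power2_le_imp_le) auto
    have Xge: "X \<ge> d * (M + N) * (d * (M + N) / 4)"
      unfolding X_def using b0 b3 d MN by (intro mult_mono) auto
    have Xge': "X \<ge> d\<^sup>2 / 16 * ((1 + M) * (1 + N))"
    proof -
      have "(1 + M + N) ^ 2 \<le> (2 * (M + N)) ^ 2" using MN by (intro power_mono) auto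
      moreover have "(1 + M) * (1 + N) \<le> (1 + M + N) ^ 2"
        using pos by (simp add: power2_eq_square algebra_simps)
      ultimately have "(1 + M) * (1 + N) \<le> (2 * (M + N)) ^ 2" by linarith
      hence "d\<^sup>2 / 16 * ((1 + M) * (1 + N)) \<le> d\<^sup>2 / 16 * (2 * (M + N)) ^ 2"
        by (intro mult_left_mono) auto
      also have "\<dots> = d * (M + N) * (d * (M + N) / 4)"
        by (simp add: power2_eq_square field_simps)
      finally show ?thesis using Xge by linarith
    qed
    have dMN: "d * (M + N) > 0" using d MN by simp
    have nz: "w \<noteq> 0" "w - 1/2 \<noteq> 0" "w + 1/2 \<noteq> 0"
      using b0 b2 dMN by fastforce+
    have "1 / w\<^sup>2 - eis_corr w = (- 1 / 4) / (w\<^sup>2 * ((w - 1/2) * (w + 1/2)))"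
    proof -
      have "eis_corr w = 1 / ((w - 1/2) * (w + 1/2))"
        unfolding eis_corr_def using nz by (subst diff_frac_eq) auto
      also have "1 / w\<^sup>2 - \<dots> = ((w - 1/2) * (w + 1/2) - w\<^sup>2) / (w\<^sup>2 * ((w - 1/2) * (w + 1/2)))"
        using nz by (subst diff_frac_eq) auto
      also have "(w - 1/2) * (w + 1/2) - w\<^sup>2 = - 1 / 4"
        by (simp add: power2_eq_square field_simps)
      finally show ?thesis .
    qed
    hence "norm (1 / w\<^sup>2 - eis_corr w) = 1 / 4 / X"
      by (simp add: norm_divide norm_mult norm_power X_def)
    also have "\<dots> \<le> 1 / 4 / (d\<^sup>2 / 16 * ((1 + M) * (1 + N)))"
      using Xge' d pos by (intro divide_left_mono mult_pos_pos) (auto intro!: divide_pos_pos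
         intro: less_le_trans[OF _ Xge'])
    also have "\<dots> = 4 / d\<^sup>2 * (1 / (1 + M) * (1 / (1 + N)))"
      by (simp add: field_simps)
    also have "\<dots> \<le> K * (1 / (1 + M) * (1 / (1 + N)))"
      using pos by (intro mult_right_mono) (auto simp: K_def)
    finally show ?thesis unfolding w_def M_def N_def .
  qed
  have "(\<lambda>(m, n). 1 / (1 + real_of_int m ^ 2) * (1 / (1 + real_of_int n ^ 2))) summable_on (UNIV \<times> UNIV)"
  proof (rule summable_on_SigmaI[where
      g = "\<lambda>m. 1 / (1 + real_of_int m ^ 2) * (\<Sum>\<^sub>\<infinity>n. 1 / (1 + real_of_int n ^ 2))"])
    show "((\<lambda>n. case (m, n) of (m, n) \<Rightarrow> 1 / (1 + real_of_int m ^ 2) * (1 / (1 + real_of_int n ^ 2))) has_sum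
            1 / (1 + real_of_int m ^ 2) * (\<Sum>\<^sub>\<infinity>n. 1 / (1 + real_of_int n ^ 2))) UNIV" for m
      unfolding prod.case by (intro has_sum_cmult_right has_sum_infsum summable_on_inverse_Suc_squares_int)
    show "(\<lambda>m. 1 / (1 + real_of_int m ^ 2) * (\<Sum>\<^sub>\<infinity>n. 1 / (1 + real_of_int n ^ 2))) summable_on UNIV"
      by (intro summable_on_cmult_left summable_on_inverse_Suc_squares_int)
  qed auto
  hence "(\<lambda>(m, n). K * (1 / (1 + real_of_int m ^ 2) * (1 / (1 + real_of_int n ^ 2)))) summable_on UNIV"
    using summable_on_cmult_right[of "\<lambda>(m, n). 1 / (1 + real_of_int m ^ 2) * (1 / (1 + real_of_int n ^ 2))" UNIV K]
    by (simp only: case_prod_unfold UNIV_Times_UNIV)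
  hence "(\<lambda>x. norm (case x of (m, n) \<Rightarrow> 1 / (of_int m * z + of_int n)\<^sup>2 -
            eis_corr (of_int m * z + of_int n))) summable_on (UNIV :: (int \<times> int) set)"
    by (rule Infinite_Sum.abs_summable_on_comparison_test') (use bound in \<open>simp only: case_prod_unfold\<close>)
  thus ?thesis by (rule abs_summable_summable)
qed

section \<open>Cotangent limits; row and column sums\<close>

lemma cot_at_upper:
  "((\<lambda>t. cot (of_real t * w)) \<longlongrightarrow> - \<i>) at_top" if w: "Im w > 0" for w :: complex
proof -
  have cot_eq: "cot x = \<i> * (exp (2 * \<i> * x) + 1) / (exp (2 * \<i> * x) - 1)" for x :: complex
  proof -
    define e where "e = exp (\<i> * x)"
    have e: "exp (2 * \<i> * x) = e * e" "exp (- (\<i> * x)) = 1 / e" "e \<noteq> 0"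
      by (simp_all add: e_def exp_add [symmetric] exp_minus inverse_eq_divide algebra_simps)
    have "cot x = ((e + 1 / e) / 2) / ((e - 1 / e) / (2 * \<i>))"
      by (simp add: cot_def sin_exp_eq cos_exp_eq e flip: e_def)
    also have "\<dots> = \<i> * (e * e + 1) / (e * e - 1)"
    proof -
      have 1: "e - 1 / e = (e * e - 1) / e" and 2: "e + 1 / e = (e * e + 1) / e"
        using e(3) by (simp_all add: field_simps)
      show ?thesis unfolding 1 2 using e(3)
        by (cases "e * e = 1") (auto simp: field_simps)
    qed
    finally show ?thesis by (simp only: e)
  qed
  have "((\<lambda>t. exp (2 * \<i> * (of_real t * w))) \<longlongrightarrow> 0) at_top"
  proof (rule tendsto_norm_zero_cancel)
    have "((\<lambda>t. exp (- 2 * Im w * t)) \<longlongrightarrow> 0) at_top"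
      using w by (intro filterlim_compose[OF exp_at_bot] filterlim_tendsto_neg_mult_at_bot[OF tendsto_const _ filterlim_ident]) auto
    thus "((\<lambda>t. norm (exp (2 * \<i> * (of_real t * w)))) \<longlongrightarrow> 0) at_top"
      by (simp add: mult_ac)
  qed
  hence "((\<lambda>t. \<i> * (exp (2 * \<i> * (of_real t * w)) + 1) / (exp (2 * \<i> * (of_real t * w)) - 1)) \<longlongrightarrow>
          \<i> * (0 + 1) / (0 - 1)) at_top"
    by (intro tendsto_intros) auto
  thus ?thesis by (simp add: cot_eq)
qed

lemma cot_at_lower:
  "((\<lambda>t. cot (of_real t * w)) \<longlongrightarrow> \<i>) at_top" if w: "Im w < 0" for w :: complex
  using tendsto_minus[OF cot_at_upper[of "- w"]] w by (simp add: cot_def)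

lemma Im_neg_inverse_pos:
  assumes "Im z > 0"
  shows "Im (- 1 / z) > 0"
proof -
  have "(Re z)\<^sup>2 + (Im z)\<^sup>2 > 0" using assms by (intro add_nonneg_pos) auto
  thus ?thesis using assms by (simp add: Im_divide)
qed

text \<open>The inner sum over \<open>n\<close> of \<open>1 / (m z + n)\<^sup>2\<close>; for \<open>m = 0\<close> the term \<open>n = 0\<close> is read as \<open>0\<close>.\<close>
definition eis_row :: "complex \<Rightarrow> int \<Rightarrow> complex" where
  "eis_row z m = (if m = 0 then of_real (pi ^ 2 / 3) else (of_real pi / sin (of_real pi * (of_int m * z))) ^ 2)"

lemma eis_row_has_sum:
  assumes z: "Im z > 0"
  shows "((\<lambda>n. 1 / (of_int m * z + of_int n) ^ 2) has_sum eis_row z m) UNIV"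
proof (cases "m = 0")
  case True
  thus ?thesis using inverse_squares_has_sum_int by (simp add: eis_row_def)
next
  case False
  hence "of_int m * z \<notin> \<int>" using z by (auto elim!: Ints_cases simp: complex_eq_iff)
  from sin_pi_partial_fractions[OF this] show ?thesis using False by (simp add: eis_row_def)
qed

text \<open>Because m z + n = -z (n (-1/z) - m), a column for z is a row for -1/z, reflected and
  scaled by 1 / z^2.\<close>

lemma eis_column_has_sum:
  assumes z: "Im z > 0"
  shows "((\<lambda>m. 1 / (of_int m * z + of_int n) ^ 2) has_sum eis_row (- 1 / z) n / z ^ 2) UNIV"
proof -
  have z': "Im (- 1 / z) > 0" "z \<noteq> 0"
    using z Im_neg_inverse_pos[OF z] by auto
  have "((\<lambda>m. inverse (z ^ 2) * (1 / (of_int n * (- 1 / z) + of_int m) ^ 2)) has_sum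
          inverse (z ^ 2) * eis_row (- 1 / z) n) UNIV"
    by (intro has_sum_cmult_right eis_row_has_sum z')
  also have "bij_betw uminus (UNIV :: int set) UNIV" by (rule bij_uminus)
  note has_sum_reindex_bij_betw[OF this, symmetric]
  also have "(\<lambda>m. inverse (z ^ 2) * (1 / (of_int n * (- 1 / z) + of_int (- m)) ^ 2)) =
               (\<lambda>m. 1 / (of_int m * z + of_int n) ^ 2)"
  proof
    fix m :: int
    have "of_int n * (- 1 / z) + of_int (- m) = - (of_int m * z + of_int n) / z"
      using z'(2) by (simp add: field_simps)
    thus "inverse (z ^ 2) * (1 / (of_int n * (- 1 / z) + of_int (- m)) ^ 2) = 1 / (of_int m * z + of_int n) ^ 2"
      using z'(2) by (simp add: power_divide power_minus' field_simps) (simp add: power2_eq_square algebra_simps)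
  qed
  finally show ?thesis by (simp add: field_simps)
qed

text \<open>Along a row the correction telescopes and both ends tend to 0. Summability is assumed so
  that the limit over blocks identifies the sum.\<close>

lemma eis_row_corr:
  assumes z: "Im z > 0"
    and "(\<lambda>n. eis_corr (of_int m * z + of_int n)) summable_on UNIV"
  shows "((\<lambda>n. eis_corr (of_int m * z + of_int n)) has_sum 0) UNIV"
proof -
  from assms(2) obtain S where S: "((\<lambda>n. eis_corr (of_int m * z + of_int n)) has_sum S) UNIV"
    by (auto simp: summable_on_def)
  define u where "u = of_int m * z - 1/2"
  have eq: "eis_corr (of_int m * z + of_int n) = 1 / (u + of_int n) - 1 / (u + of_int (n + 1))" for n
    by (simp add: eis_corr_def u_def algebra_simps)
  have "(\<lambda>N. 1 / (u + of_int (- int N)) - 1 / (u + of_int (int N))) \<longlonglongrightarrow> S"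
    using has_sum_int_LIMSEQ[OF S] unfolding eq telescope_int[of "\<lambda>n. 1 / (u + of_int n)"] .
  moreover have "(\<lambda>N. 1 / (u + of_int (- int N)) - 1 / (u + of_int (int N))) \<longlonglongrightarrow> 0"
  proof -
    have "filterlim (\<lambda>N. u + of_int (int N)) at_infinity sequentially" for u :: complex
      by (intro tendsto_add_filterlim_at_infinity[OF tendsto_const]) (simp add: tendsto_of_nat)
    hence *: "(\<lambda>N. 1 / (u + of_int (int N))) \<longlonglongrightarrow> 0" for u :: complex
      by (intro tendsto_divide_0[OF tendsto_const])
    have "(\<lambda>N. - (1 / (- u + of_int (int N))) - 1 / (u + of_int (int N))) \<longlonglongrightarrow> - 0 - 0"
      by (intro tendsto_intros *)
    moreover have "- (1 / (- u + of_int (int N))) = 1 / (u + of_int (- int N))" for N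
    proof -
      have "u + of_int (- int N) = - (- u + of_int (int N))" by simp
      thus ?thesis by (simp only: divide_minus_right)
    qed
    ultimately show ?thesis by (simp only:) simp
  qed
  ultimately have "S = 0" by (rule LIMSEQ_unique)
  with S show ?thesis by simp
qed

text \<open>Along a column the two halves of \<open>eis_corr\<close> do not telescope; each is a
  cotangent series in (n - 1/2) / z. The resulting column totals telescope only afterwards, in
  \<open>n\<close>.\<close>

lemma eis_column_corr:
  assumes z: "Im z > 0"
    and "(\<lambda>m. eis_corr (of_int m * z + of_int n)) summable_on UNIV"
  defines "C \<equiv> (\<lambda>n::int. of_real pi / z * cot (of_real pi * (of_int n - 1/2) / z))"
  shows "((\<lambda>m. eis_corr (of_int m * z + of_int n)) has_sum (C n - C (n + 1))) UNIV"
proof -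
  have z0: "z \<noteq> 0" using z by auto
  from assms(2) obtain S where S: "((\<lambda>m. eis_corr (of_int m * z + of_int n)) has_sum S) UNIV"
    by (auto simp: summable_on_def)
  have C: "(\<lambda>N. \<Sum>m\<in>{- int N..<int N}. 1 / (of_int m * z + (of_int n - 1/2))) \<longlonglongrightarrow> C n" for n :: int
  proof -
    define t where "t = real_of_int n - 1/2"
    have t: "of_int n - 1/2 = complex_of_real t" "t \<noteq> 0"
    proof -
      have "2 * n \<noteq> 1" by presburger
      hence "real_of_int (2 * n) \<noteq> 1" by linarith
      thus "t \<noteq> 0" by (simp add: t_def)
    qed (simp add: t_def)
    \<comment> \<open>A nonzero real number is never an integer multiple of the nonreal
      \<open>z\<close>.\<close>
    have "of_real t / z \<notin> \<int>"
    proof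
      assume "of_real t / z \<in> \<int>"
      then obtain k where "of_real t / z = of_int k" by (auto elim: Ints_cases)
      hence "complex_of_real t = of_int k * z" using z0 by (simp add: field_simps)
      with t(2) z show False by (auto simp: complex_eq_iff)
    qed
    from tendsto_mult_left[OF cot_partial_fractions[OF this], of "1 / z"]
    have "(\<lambda>N. \<Sum>m\<in>{- int N..<int N}. 1 / z * (1 / (of_real t / z + of_int m))) \<longlonglongrightarrow> C n"
      unfolding C_def t sum_distrib_left by (simp add: mult.assoc)
    moreover have "1 / z * (1 / (of_real t / z + of_int m)) = 1 / (of_int m * z + of_real t)" for m :: int
      using z0 by (simp add: field_simps)
    ultimately show ?thesis by (simp only: t)
  qed
  have eq: "eis_corr (of_int m * z + of_int n) =
              1 / (of_int m * z + (of_int n - 1/2)) - 1 / (of_int m * z + (of_int (n + 1) - 1/2))" for m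
    by (simp add: eis_corr_def algebra_simps)
  have "(\<lambda>N. (\<Sum>m\<in>{- int N..<int N}. 1 / (of_int m * z + (of_int n - 1/2))) -
             (\<Sum>m\<in>{- int N..<int N}. 1 / (of_int m * z + (of_int (n + 1) - 1/2)))) \<longlonglongrightarrow> S"
    using has_sum_int_LIMSEQ[OF S] unfolding eq sum_subtractf .
  moreover have "(\<lambda>N. (\<Sum>m\<in>{- int N..<int N}. 1 / (of_int m * z + (of_int n - 1/2))) -
             (\<Sum>m\<in>{- int N..<int N}. 1 / (of_int m * z + (of_int (n + 1) - 1/2)))) \<longlonglongrightarrow> C n - C (n + 1)"
    by (intro tendsto_diff C)
  ultimately have "S = C n - C (n + 1)" by (rule LIMSEQ_unique)
  with S show ?thesis by simp
qed

definition eis_term :: "complex \<Rightarrow> int \<times> int \<Rightarrow> complex" where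
  "eis_term z = (\<lambda>(m, n). 1 / (of_int m * z + of_int n)\<^sup>2 - eis_corr (of_int m * z + of_int n))"

lemma eis_rows_has_sum:
  assumes z: "Im z > 0" and S: "(eis_term z has_sum S) (UNIV \<times> UNIV)"
  shows "(eis_row z has_sum S) UNIV"
proof (rule has_sum_SigmaD[OF S])
  fix m :: int
  have "(\<lambda>(m, n). eis_term z (m, n)) summable_on (UNIV \<times> UNIV)"
    using S by (auto simp: summable_on_def)
  from summable_on_SigmaD1[OF this, of m]
  obtain A where A: "((\<lambda>n. eis_term z (m, n)) has_sum A) UNIV"
    by (auto simp: summable_on_def)
  \<comment> \<open>Along a single row the inverse squares and the full term are both summable,
    hence so is the correction alone.\<close>
  have "(\<lambda>n. eis_corr (of_int m * z + of_int n)) summable_on UNIV"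
    using has_sum_diff[OF eis_row_has_sum[OF z, of m] A]
    by (auto simp: summable_on_def eis_term_def)
  from has_sum_diff[OF eis_row_has_sum[OF z, of m] eis_row_corr[OF z this]]
  show "((\<lambda>n. eis_term z (m, n)) has_sum eis_row z m) UNIV" by (simp add: eis_term_def)
qed

lemma eis_columns_has_sum:
  fixes z :: complex
  defines "C \<equiv> (\<lambda>n::int. of_real pi / z * cot (of_real pi * (of_int n - 1/2) / z))"
  assumes z: "Im z > 0" and S: "(eis_term z has_sum S) (UNIV \<times> UNIV)"
  shows "((\<lambda>n. eis_row (- 1 / z) n / z ^ 2 - (C n - C (n + 1))) has_sum S) UNIV"
proof -
  have S': "((\<lambda>(n, m). eis_term z (m, n)) has_sum S) (UNIV \<times> UNIV)"
    using S by (subst (asm) has_sum_swap) (simp add: case_prod_unfold)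
  show ?thesis
  proof (rule has_sum_SigmaD[OF S'])
    fix n :: int
    have "(\<lambda>(n, m). eis_term z (m, n)) summable_on (UNIV \<times> UNIV)"
      using S' by (auto simp: summable_on_def)
    from summable_on_SigmaD1[OF this, of n]
    obtain A where A: "((\<lambda>m. eis_term z (m, n)) has_sum A) UNIV"
      by (auto simp: summable_on_def)
    have "(\<lambda>m. eis_corr (of_int m * z + of_int n)) summable_on UNIV"
      using has_sum_diff[OF eis_column_has_sum[OF z, of n] A]
      by (auto simp: summable_on_def eis_term_def)
    from has_sum_diff[OF eis_column_has_sum[OF z, of n] eis_column_corr[OF z this]]
    show "((\<lambda>m. case (n, m) of (n, m) \<Rightarrow> eis_term z (m, n)) has_sum
             eis_row (- 1 / z) n / z ^ 2 - (C n - C (n + 1))) UNIV"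
      by (simp add: eis_term_def C_def)
  qed
qed

text \<open>
  Exchanging the order of summation replaces \<open>z\<close> by \<open>-1/z\<close>, up to the telescoping corrections of
  the columns, whose limits at infinity produce the extra term \<open>2 \<pi> \<i> z\<close>.
\<close>
lemma eis_row_transformation:
  assumes z: "Im z > 0"
  obtains S where "(eis_row z has_sum S) UNIV"
    and "(eis_row (- 1 / z) has_sum (z ^ 2 * S - 2 * of_real pi * \<i> * z)) UNIV"
proof -
  have z0: "z \<noteq> 0" using z by auto
  define C where "C = (\<lambda>n::int. of_real pi / z * cot (of_real pi * (of_int n - 1/2) / z))"
  have *: "\<exists>S. (eis_term z has_sum S) (UNIV \<times> UNIV)" if "Im z > 0" for z
    using eis_summable[OF that] by (simp add: eis_term_def summable_on_def)
  from *[OF z] obtain S where S: "(eis_term z has_sum S) (UNIV \<times> UNIV)" ..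
  from *[OF Im_neg_inverse_pos[OF z]]
  obtain T where "(eis_term (- 1 / z) has_sum T) (UNIV \<times> UNIV)" ..
  hence T: "(eis_row (- 1 / z) has_sum T) UNIV"
    by (rule eis_rows_has_sum[OF Im_neg_inverse_pos[OF z]])
  have "((\<lambda>n. inverse (z ^ 2) * eis_row (- 1 / z) n) has_sum inverse (z ^ 2) * T) UNIV"
    by (intro has_sum_cmult_right T)
  from has_sum_diff[OF this eis_columns_has_sum[OF z S]]
  have "((\<lambda>n. C n - C (n + 1)) has_sum (T / z ^ 2 - S)) UNIV"
    by (simp add: field_simps C_def)
  from has_sum_int_LIMSEQ[OF this]
  have "(\<lambda>N. C (- int N) - C (int N)) \<longlonglongrightarrow> T / z ^ 2 - S"
    by (simp only: telescope_int)
  \<comment> \<open>The cotangent arguments go to infinity along the ray of w = -1/z for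
    \<open>C (- int N)\<close> and along that of -w for \<open>C (int N)\<close>, in opposite half
    planes. The limits -i and i add up instead of cancelling.\<close>
  moreover have "(\<lambda>N. C (- int N) - C (int N)) \<longlonglongrightarrow> of_real pi / z * (- \<i>) - of_real pi / z * \<i>"
  proof (intro tendsto_diff)
    define w where "w = - 1 / z"
    have w: "Im w > 0" unfolding w_def by (rule Im_neg_inverse_pos[OF z])
    have "filterlim (\<lambda>N. pi * (real N + 1/2)) at_top sequentially" by real_asymp
    from filterlim_compose[OF cot_at_upper[OF w] this]
    have "(\<lambda>N. of_real pi / z * cot (of_real (pi * (real N + 1/2)) * w)) \<longlonglongrightarrow> of_real pi / z * (- \<i>)"
      by (intro tendsto_intros)
    moreover have "of_real (pi * (real N + 1/2)) * w = of_real pi * (of_int (- int N) - 1/2) / z" for N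
    proof -
      have "of_real pi * (of_int (- int N) - 1/2) = - complex_of_real (pi * (real N + 1/2))"
        by (simp add: algebra_simps)
      thus ?thesis by (simp add: w_def)
    qed
    ultimately show "(\<lambda>N. C (- int N)) \<longlonglongrightarrow> of_real pi / z * (- \<i>)" by (simp only: C_def)
    have "filterlim (\<lambda>N. pi * (real N - 1/2)) at_top sequentially" by real_asymp
    from filterlim_compose[OF cot_at_lower[of "- w"] this]
    have "(\<lambda>N. of_real pi / z * cot (of_real (pi * (real N - 1/2)) * (- w))) \<longlonglongrightarrow> of_real pi / z * \<i>"
      using w by (intro tendsto_intros) auto
    moreover have "of_real (pi * (real N - 1/2)) * (- w) = of_real pi * (of_int (int N) - 1/2) / z" for N
      by (simp add: w_def field_simps)
    ultimately show "(\<lambda>N. C (int N)) \<longlonglongrightarrow> of_real pi / z * \<i>" by (simp only: C_def)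
  qed
  ultimately have "T / z ^ 2 - S = of_real pi / z * (- \<i>) - of_real pi / z * \<i>"
    by (rule LIMSEQ_unique)
  moreover have "T = z ^ 2 * (T / z ^ 2 - S) + z ^ 2 * S"
    using z0 by (simp add: right_diff_distrib)
  ultimately have "T = z ^ 2 * (of_real pi / z * (- \<i>) - of_real pi / z * \<i>) + z ^ 2 * S"
    by simp
  also have "\<dots> = z ^ 2 * S - 2 * of_real pi * \<i> * z"
    using z0 by (simp add: power2_eq_square)
  finally have "T = z ^ 2 * S - 2 * of_real pi * \<i> * z" .
  with T eis_rows_has_sum[OF z S] show thesis by (intro that) simp_all
qed

section \<open>From the row sums to the q-expansion of E2\<close>

lemma geometric_deriv_has_sum:
  fixes y :: "'a :: {real_normed_field, banach}"
  assumes "norm y < 1"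
  shows "((\<lambda>k. of_nat (Suc k) * y ^ Suc k) has_sum y / (1 - y) ^ 2) UNIV"
proof (rule norm_summable_imp_has_sum)
  have "(\<lambda>k. y * (of_nat (Suc k) * y ^ k)) sums (y * (1 / (1 - y) ^ 2))"
    by (intro sums_mult geometric_deriv_sums assms)
  thus "(\<lambda>k. of_nat (Suc k) * y ^ Suc k) sums (y / (1 - y) ^ 2)"
    by (simp add: mult_ac)
  have "summable (\<lambda>k. norm y * (of_nat (Suc k) * norm y ^ k))"
    using geometric_deriv_sums[of "norm y"] assms by (intro summable_mult) (simp add: sums_iff)
  thus "summable (\<lambda>k. norm (of_nat (Suc k) * y ^ Suc k))"
    by (simp add: norm_mult norm_power mult_ac del: of_nat_Suc)
qed

text \<open>Each Lambert term expands as the sum over k of k q^(m k); collecting the pairs with m k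
  = n leaves the sum of the divisors k of n. Absolute summability, checked first at
  \<open>norm q\<close>, justifies the regrouping.\<close>

lemma lambert_sigma1:
  fixes q :: complex
  assumes q: "norm q < 1"
  shows "((\<lambda>m. q ^ Suc m / (1 - q ^ Suc m) ^ 2) has_sum (\<Sum>n. of_nat (sigma1 (Suc n)) * q ^ Suc n)) UNIV"
    and "summable (\<lambda>n. of_nat (sigma1 (Suc n)) * q ^ Suc n)"
proof -
  define F where "F = (\<lambda>(m, k). of_nat (Suc k) * q ^ (Suc m * Suc k))"
  have small: "norm y ^ Suc m < 1" if "norm y < 1" for y :: "'a :: real_normed_field" and m
    using power_decreasing[of 1 "Suc m" "norm y"] that by simp
  have row: "((\<lambda>k. of_nat (Suc k) * y ^ (Suc m * Suc k)) has_sum y ^ Suc m / (1 - y ^ Suc m) ^ 2) UNIV"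
    if "norm y < 1" for y :: "'a :: {real_normed_field, banach}" and m
    using geometric_deriv_has_sum[of "y ^ Suc m"] small[OF that, of m]
    by (simp only: norm_power power_mult)
  define x where "x = norm q"
  have x: "0 \<le> x" "x < 1" using q by (auto simp: x_def)
  have "(\<lambda>(m, k). real (Suc k) * x ^ (Suc m * Suc k)) summable_on (UNIV \<times> UNIV)"
  proof (rule summable_on_SigmaI[where g = "\<lambda>m. x ^ Suc m / (1 - x ^ Suc m) ^ 2"])
    fix m :: nat
    show "((\<lambda>k. case (m, k) of (m, k) \<Rightarrow> real (Suc k) * x ^ (Suc m * Suc k)) has_sum
            x ^ Suc m / (1 - x ^ Suc m) ^ 2) UNIV"
      using row[of x m] x by simp
  next
    show "(\<lambda>m. x ^ Suc m / (1 - x ^ Suc m) ^ 2) summable_on UNIV"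
    proof (rule norm_summable_imp_summable_on, rule summable_comparison_test)
      show "summable (\<lambda>m. x ^ Suc m / (1 - x) ^ 2)"
        using x by (intro summable_divide) (simp add: summable_mult)
      show "\<exists>N. \<forall>m\<ge>N. norm (norm (x ^ Suc m / (1 - x ^ Suc m) ^ 2)) \<le> x ^ Suc m / (1 - x) ^ 2"
      proof (intro exI allI impI)
        fix m :: nat
        have "x ^ Suc m \<le> x" using x power_decreasing[of 1 "Suc m" x] by simp
        hence "(1 - x) ^ 2 \<le> (1 - x ^ Suc m) ^ 2" using x by (intro power_mono) auto
        moreover have "(1 - x) ^ 2 > 0" using x by simp
        ultimately have "x ^ Suc m / (1 - x ^ Suc m) ^ 2 \<le> x ^ Suc m / (1 - x) ^ 2"
          using x by (intro divide_left_mono mult_pos_pos) auto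
        thus "norm (norm (x ^ Suc m / (1 - x ^ Suc m) ^ 2)) \<le> x ^ Suc m / (1 - x) ^ 2"
          using x by simp
      qed
    qed
  qed (use x in auto)
  hence "(\<lambda>x. norm (F x)) summable_on (UNIV \<times> UNIV)"
    by (simp only: F_def case_prod_unfold norm_mult norm_power norm_of_nat x_def)
  hence "F summable_on (UNIV \<times> UNIV)" by (rule abs_summable_summable)
  then obtain S where S: "(F has_sum S) (UNIV \<times> UNIV)" by (auto simp: summable_on_def)
  have rows: "((\<lambda>m. q ^ Suc m / (1 - q ^ Suc m) ^ 2) has_sum S) UNIV"
    by (rule has_sum_SigmaD[OF S]) (use row[OF q] in \<open>simp add: F_def\<close>)
  define D where "D = (\<lambda>n. {d. d dvd Suc n})"
  \<comment> \<open>All indices are shifted by one: the pair of factors \<open>Suc m\<close>,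
    \<open>Suc k\<close> goes to the index of their product together with its divisor
    \<open>Suc k\<close>.\<close>
  have "bij_betw (\<lambda>(m, k). (Suc m * Suc k - 1, Suc k)) (UNIV \<times> UNIV) (Sigma UNIV D)"
  proof (rule bij_betwI[of _ _ _ "\<lambda>(n, d). (Suc n div d - 1, d - 1)"])
    show "(\<lambda>(m, k). (Suc m * Suc k - 1, Suc k)) \<in> UNIV \<times> UNIV \<rightarrow> Sigma UNIV D"
      by (auto simp: D_def simp del: mult_Suc mult_Suc_right)
    show "(\<lambda>(n, d). (Suc n div d - 1, d - 1)) ((\<lambda>(m, k). (Suc m * Suc k - 1, Suc k)) x) = x" for x :: "nat \<times> nat"
    proof (cases x)
      case (Pair m k)
      have "Suc (Suc m * Suc k - 1) = Suc m * Suc k" by simp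
      thus ?thesis unfolding Pair prod.case by (simp del: mult_Suc mult_Suc_right)
    qed
    fix y assume "y \<in> Sigma UNIV D"
    then obtain n d where y: "y = (n, d)" "d dvd Suc n" by (auto simp: D_def)
    then obtain e where e: "Suc n = d * e" by (auto elim: dvdE)
    hence "d > 0" "e > 0" by (auto intro!: gr0I)
    moreover from this have "Suc n div d = e" "Suc (e - 1) = e" "Suc (d - 1) = d" "e * d - 1 = n"
      using diff_Suc_1[of n] by (simp_all add: e mult.commute[of e d])
    ultimately show "(\<lambda>(m, k). (Suc m * Suc k - 1, Suc k)) ((\<lambda>(n, d). (Suc n div d - 1, d - 1)) y) = y"
      by (simp only: y prod.case)
  qed auto
  from has_sum_reindex_bij_betw[OF this, of "\<lambda>(n, d). of_nat d * q ^ Suc n" S]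
  have G: "((\<lambda>(n, d). of_nat d * q ^ Suc n) has_sum S) (Sigma UNIV D)"
    using S by (simp add: F_def case_prod_unfold)
  have "((\<lambda>n. of_nat (sigma1 (Suc n)) * q ^ Suc n) has_sum S) UNIV"
  proof (rule has_sum_SigmaD[OF G])
    fix n
    show "((\<lambda>d. case (n, d) of (n, d) \<Rightarrow> of_nat d * q ^ Suc n) has_sum of_nat (sigma1 (Suc n)) * q ^ Suc n) (D n)"
      by (rule has_sum_finiteI) (auto simp: D_def sigma1_def sum_distrib_right)
  qed
  hence sums: "(\<lambda>n. of_nat (sigma1 (Suc n)) * q ^ Suc n) sums S" by (rule has_sum_imp_sums)
  show "summable (\<lambda>n. of_nat (sigma1 (Suc n)) * q ^ Suc n)" using sums by (simp add: sums_iff)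
  show "((\<lambda>m. q ^ Suc m / (1 - q ^ Suc m) ^ 2) has_sum (\<Sum>n. of_nat (sigma1 (Suc n)) * q ^ Suc n)) UNIV"
    using rows sums by (simp add: sums_iff)
qed

lemma norm_q_param: "norm (q_param z) = exp (- 2 * pi * Im z)"
  by (simp add: q_param_def)

lemma norm_q_param_less_1: "Im z > 0 \<Longrightarrow> norm (q_param z) < 1"
  by (simp add: norm_q_param)

text \<open>With e = exp(i x) one has sin(x)^2 = -(1 - e^2)^2 / (4 e^2), and here e^2 is the power
  of q.\<close>

lemma eis_row_eq:
  assumes z: "Im z > 0"
  shows "eis_row z (int (Suc m)) = - 4 * of_real (pi ^ 2) * (q_param z ^ Suc m / (1 - q_param z ^ Suc m) ^ 2)"
proof -
  define x where "x = of_real pi * (of_int (int (Suc m)) * z)"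
  define e where "e = exp (\<i> * x)"
  have e: "e \<noteq> 0" "exp (- (\<i> * x)) = 1 / e" by (simp_all add: e_def exp_minus inverse_eq_divide)
  have q: "q_param z ^ Suc m = e ^ 2"
    unfolding q_param_def e_def x_def exp_of_nat_mult [symmetric] by (simp add: algebra_simps)
  have "norm (q_param z) ^ Suc m < 1"
    using power_decreasing[of 1 "Suc m" "norm (q_param z)"] norm_q_param_less_1[OF z] by simp
  hence "e ^ 2 \<noteq> 1" using q by (metis less_irrefl norm_one norm_power)
  have "sin x = (e - 1 / e) / (2 * \<i>)"
    by (simp add: sin_exp_eq e flip: e_def)
  also have "\<dots> = (e ^ 2 - 1) / (2 * \<i> * e)"
    using e(1) by (simp add: field_simps power2_eq_square)
  finally have "sin x ^ 2 = (1 - e ^ 2) ^ 2 / (- 4 * e ^ 2)"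
    by (simp add: power_divide power_mult_distrib power2_commute)
  hence "eis_row z (int (Suc m)) = of_real pi ^ 2 / ((1 - e ^ 2) ^ 2 / (- 4 * e ^ 2))"
    unfolding eis_row_def x_def [symmetric] by (simp add: power_divide)
  thus ?thesis unfolding q by (simp del: of_nat_Suc)
qed

lemma eis_row_uminus: "eis_row z (- m) = eis_row z m"
  by (simp add: eis_row_def power_divide)

text \<open>Row 0 gives pi^2/3; the rows m and -m agree, so the Lambert series enters twice with
  factor -4 pi^2. This produces the coefficient -24 relative to pi^2/3.\<close>

lemma eis_row_sum_E2:
  assumes z: "Im z > 0"
  shows "(eis_row z has_sum of_real (pi ^ 2 / 3) * E2 z) UNIV"
proof -
  define L where "L = (\<Sum>n. of_nat (sigma1 (Suc n)) * q_param z ^ Suc n)"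
  define c where "c = complex_of_real (pi ^ 2)"
  have B: "((\<lambda>m. eis_row z (int (Suc m))) has_sum - 4 * c * L) UNIV"
    unfolding eis_row_eq[OF z] L_def c_def
    by (intro has_sum_cmult_right lambert_sigma1 norm_q_param_less_1 z)
  hence "((\<lambda>m. eis_row z (int m)) has_sum - 4 * c * L) (range Suc)"
    by (subst has_sum_reindex) (auto simp: o_def)
  hence "((\<lambda>m. eis_row z (int m)) has_sum (eis_row z (int 0) + - 4 * c * L)) (insert 0 (range Suc))"
    by (intro has_sum_insert) auto
  also have "insert 0 (range Suc) = UNIV"
    using not0_implies_Suc by (auto simp: image_iff)
  also have "eis_row z (int 0) = c / 3" by (simp add: eis_row_def c_def)
  finally have A: "((\<lambda>m. eis_row z (int m)) has_sum (c / 3 + - 4 * c * L)) UNIV" .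
  have "(eis_row z has_sum (c / 3 + - 4 * c * L + - 4 * c * L)) UNIV"
    by (rule has_sum_int[OF A]) (use B in \<open>simp only: eis_row_uminus\<close>)
  also have "c / 3 + - 4 * c * L + - 4 * c * L = of_real (pi ^ 2 / 3) * E2 z"
    by (simp add: E2_def c_def algebra_simps flip: L_def power_Suc of_nat_Suc)
  finally show ?thesis .
qed

text \<open>Two evaluations of the row sums at -1/z are compared; the defect 2 pi i z divided by
  pi^2/3 becomes the constant 6 / (pi i).\<close>

lemma E2_transformation:
  assumes z: "Im z > 0"
  shows "E2 (- 1 / z) = z ^ 2 * E2 z + 6 / (of_real pi * \<i>) * z"
proof -
  obtain S where S: "(eis_row z has_sum S) UNIV"
    "(eis_row (- 1 / z) has_sum (z ^ 2 * S - 2 * of_real pi * \<i> * z)) UNIV"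
    using eis_row_transformation[OF z] by blast
  have "S = of_real (pi ^ 2 / 3) * E2 z"
    using has_sum_unique[OF S(1) eis_row_sum_E2[OF z]] .
  moreover have "z ^ 2 * S - 2 * of_real pi * \<i> * z = of_real (pi ^ 2 / 3) * E2 (- 1 / z)"
    using has_sum_unique[OF S(2) eis_row_sum_E2[OF Im_neg_inverse_pos[OF z]]] .
  hence "of_real (pi ^ 2) * E2 (- 1 / z) = 3 * (z ^ 2 * S - 2 * of_real pi * \<i> * z)"
    by (simp only: of_real_divide) (simp add: field_simps)
  ultimately have "of_real (pi ^ 2) * E2 (- 1 / z) = of_real (pi ^ 2) * z ^ 2 * E2 z - 6 * of_real pi * \<i> * z"
    by (simp add: algebra_simps)
  hence "of_real (pi ^ 2) * E2 (- 1 / z) = of_real (pi ^ 2) * (z ^ 2 * E2 z + 6 / (of_real pi * \<i>) * z)"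
    by (simp add: distrib_left power2_eq_square)
  thus ?thesis by (subst (asm) mult_left_cancel) auto
qed

section \<open>The discriminant and the order at the cusp\<close>

text \<open>
  \<open>q * Delta_hat q\<close> is the modular discriminant, written as the exponential of the integral of \<open>E2\<close>
  rather than as an infinite product.
\<close>
definition Delta_hat :: "complex \<Rightarrow> complex" where
  "Delta_hat q = exp (- 24 * (\<Sum>n. of_nat (sigma1 n) / of_nat n * q ^ n))"

lemma summable_sigma1:
  assumes "norm (q :: complex) < 1"
  shows "summable (\<lambda>n. of_nat (sigma1 n) * q ^ n)"
  using lambert_sigma1(2)[OF assms] by (subst (asm) summable_Suc_iff)

text \<open>Termwise differentiation cancels the denominators n. The term with index 0 is 0 by
  division by zero.\<close>

lemma has_field_derivative_sigma1_series:
  assumes "norm (q :: complex) < 1"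
  shows "((\<lambda>q. \<Sum>n. of_nat (sigma1 n) / of_nat n * q ^ n) has_field_derivative
            (\<Sum>n. of_nat (sigma1 (Suc n)) * q ^ n)) (at q)"
proof -
  define c where "c = (\<lambda>n. complex_of_nat (sigma1 n) / of_nat n)"
  have summable_c: "summable (\<lambda>n. c n * q ^ n)" if "norm q < 1" for q
  proof (rule summable_comparison_test)
    have "summable (\<lambda>n. of_nat (sigma1 n) * complex_of_real (norm q) ^ n)"
      using summable_sigma1[of "of_real (norm q)"] that by simp
    hence "summable (\<lambda>n. complex_of_real (of_nat (sigma1 n) * norm q ^ n))" by simp
    thus "summable (\<lambda>n. of_nat (sigma1 n) * norm q ^ n)" by (subst (asm) summable_of_real_iff)
    show "\<exists>N. \<forall>n\<ge>N. norm (c n * q ^ n) \<le> real (sigma1 n) * norm q ^ n"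
    proof (intro exI[of _ 1] allI impI)
      fix n :: nat assume "n \<ge> 1"
      hence "norm (c n) \<le> real (sigma1 n)"
        using mult_left_mono[of 1 "real n" "real (sigma1 n)"] by (simp add: c_def norm_divide field_simps)
      thus "norm (c n * q ^ n) \<le> real (sigma1 n) * norm q ^ n"
        by (simp add: norm_mult norm_power mult_right_mono)
    qed
  qed
  have d: "diffs c n = of_nat (sigma1 (Suc n))" for n
    by (simp add: diffs_def c_def del: of_nat_Suc)
  from termdiffs_strong'[of 1 c q] summable_c assms show ?thesis
    unfolding d unfolding c_def by simp
qed

lemma has_field_derivative_Delta_hat:
  assumes q: "norm q < 1"
  shows "((\<lambda>q. q * Delta_hat q) has_field_derivative
            Delta_hat q * (1 - 24 * (\<Sum>n. of_nat (sigma1 (Suc n)) * q ^ Suc n))) (at q)"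
proof -
  define S where "S = (\<lambda>q. \<Sum>n. complex_of_nat (sigma1 n) / of_nat n * q ^ n)"
  have S: "(S has_field_derivative (\<Sum>n. of_nat (sigma1 (Suc n)) * q ^ n)) (at q)"
    unfolding S_def by (rule has_field_derivative_sigma1_series[OF q])
  have Delta_hat: "Delta_hat = (\<lambda>q. exp (- 24 * S q))"
    by (simp add: Delta_hat_def [abs_def] S_def)
  have "((\<lambda>q. q * Delta_hat q) has_field_derivative
            Delta_hat q + q * (Delta_hat q * (- 24 * (\<Sum>n. of_nat (sigma1 (Suc n)) * q ^ n)))) (at q)"
    unfolding Delta_hat by (rule derivative_eq_intros refl S)+ simp
  also have "q * (\<Sum>n. of_nat (sigma1 (Suc n)) * q ^ n) = (\<Sum>n. of_nat (sigma1 (Suc n)) * q ^ Suc n)"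
  proof (cases "q = 0")
    case False
    have "summable (\<lambda>n. inverse q * (of_nat (sigma1 (Suc n)) * q ^ Suc n))"
      by (intro summable_mult lambert_sigma1(2) q)
    hence "summable (\<lambda>n. of_nat (sigma1 (Suc n)) * q ^ n)"
      using False by (simp add: mult_ac)
    from suminf_mult[OF this, of q] show ?thesis by (simp add: mult_ac)
  qed auto
  hence "Delta_hat q + q * (Delta_hat q * (- 24 * (\<Sum>n. of_nat (sigma1 (Suc n)) * q ^ n))) =
         Delta_hat q * (1 - 24 * (\<Sum>n. of_nat (sigma1 (Suc n)) * q ^ Suc n))"
    by (simp add: algebra_simps)
  finally show ?thesis .
qed

lemma Delta_hat_nonzero: "Delta_hat q \<noteq> 0"
  by (simp add: Delta_hat_def)

lemma Delta_hat_holomorphic: "Delta_hat holomorphic_on ball 0 1"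
proof -
  have "(\<lambda>q. \<Sum>n. of_nat (sigma1 n) / of_nat n * q ^ n) holomorphic_on ball (0 :: complex) 1"
    unfolding holomorphic_on_open[OF open_ball]
    by (intro ballI exI, rule has_field_derivative_sigma1_series) simp
  thus ?thesis unfolding Delta_hat_def [abs_def] by (intro holomorphic_intros)
qed

definition Delta :: "complex \<Rightarrow> complex" where
  "Delta z = q_param z * Delta_hat (q_param z)"

lemma Delta_nonzero: "Delta z \<noteq> 0"
  by (simp add: Delta_def Delta_hat_nonzero q_param_def)

lemma q_param_has_field_derivative [derivative_intros]:
  "(q_param has_field_derivative (2 * of_real pi * \<i> * q_param z)) (at z within A)"
  unfolding q_param_def [abs_def] by (auto intro!: derivative_eq_intros)

lemma Delta_has_field_derivative:
  assumes z: "Im z > 0"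
  shows "(Delta has_field_derivative (2 * of_real pi * \<i> * E2 z * Delta z)) (at z)"
proof -
  have "((\<lambda>z. q_param z * Delta_hat (q_param z)) has_field_derivative
          (Delta_hat (q_param z) * E2 z) * (2 * of_real pi * \<i> * q_param z)) (at z)"
    using DERIV_chain2[OF has_field_derivative_Delta_hat[OF norm_q_param_less_1[OF z]]
       q_param_has_field_derivative[of z UNIV]] by (simp add: E2_def)
  thus ?thesis by (simp add: Delta_def [abs_def] mult_ac)
qed

section \<open>Modularity of the discriminant and the bound on the order\<close>

lemma convex_upper_half_plane: "convex {z. Im z > 0}"
  by (rule convex_halfspace_Im_gt)

text \<open>Both sides have logarithmic derivative 2 pi i E2(z) + 12/z, the 12 being 2 pi i times 6
  / (pi i). So their quotient is constant, and at the fixed point i it is 1 because i^12 =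
  1.\<close>

lemma Delta_transformation:
  assumes z: "Im z > 0"
  shows "Delta (- 1 / z) = z ^ 12 * Delta z"
proof -
  define F where "F = (\<lambda>z. Delta (- 1 / z) / (z ^ 12 * Delta z))"
  have "(F has_field_derivative 0) (at z within {z. Im z > 0})" if "z \<in> {z. Im z > 0}" for z
  proof -
    from that have z: "Im z > 0" "z \<noteq> 0" by auto
    have "((\<lambda>z. Delta (- 1 / z)) has_field_derivative
            (2 * of_real pi * \<i> * E2 (- 1 / z) * Delta (- 1 / z)) * (1 / z ^ 2)) (at z)"
      by (rule DERIV_chain2[where f = Delta and g = "\<lambda>z. - 1 / z"])
         (use z Delta_has_field_derivative[OF Im_neg_inverse_pos[OF z(1)]] in
           \<open>auto intro!: derivative_eq_intros simp: power2_eq_square\<close>)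
    also have "(2 * of_real pi * \<i> * E2 (- 1 / z) * Delta (- 1 / z)) * (1 / z ^ 2) =
                 (2 * of_real pi * \<i> * E2 z + 12 / z) * Delta (- 1 / z)"
      unfolding E2_transformation[OF z(1)] using z(2) by (simp add: field_simps power2_eq_square)
    finally have 1: "((\<lambda>z. Delta (- 1 / z)) has_field_derivative
                 (2 * of_real pi * \<i> * E2 z + 12 / z) * Delta (- 1 / z)) (at z)" .
    have 2: "((\<lambda>z. z ^ 12 * Delta z) has_field_derivative
                 (2 * of_real pi * \<i> * E2 z + 12 / z) * (z ^ 12 * Delta z)) (at z)"
      using z by (auto intro!: derivative_eq_intros Delta_has_field_derivative
                       simp: field_simps power_numeral_reduce)
    have "(F has_field_derivative 0) (at z)"
      unfolding F_def using DERIV_divide[OF 1 2] z by (simp add: Delta_nonzero algebra_simps)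
    thus ?thesis by (rule has_field_derivative_at_within)
  qed
  then obtain c where c: "\<And>z. Im z > 0 \<Longrightarrow> F z = c"
    using has_field_derivative_zero_constant[OF convex_upper_half_plane, of F] by auto
  have "F \<i> = 1"
  proof -
    have "\<i> ^ 12 = (1 :: complex)" using i_even_power[of 6] by simp
    thus ?thesis by (simp add: F_def Delta_nonzero)
  qed
  with c[of \<i>] c[OF z] have "F z = 1" by simp
  thus ?thesis using z by (simp add: F_def divide_eq_1_iff)
qed

text \<open>
  The maximum of \<open>\<bar>Y (q_param z)\<bar>\<close> over \<open>Im z \<ge> 1/2\<close> is attained at a point with \<open>Im z = 1/2\<close> and \<open>\<bar>Re z\<bar> \<le> 1/2\<close>; such a point
  satisfies \<open>\<bar>z\<bar> < 1\<close>, so that \<open>-1/z\<close> lies higher up and gives a larger value.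
\<close>
lemma no_negative_weight:
  assumes Y: "Y holomorphic_on ball 0 1" "Y 0 \<noteq> 0" and j: "j > 0"
  assumes inv: "\<And>z. Im z > 0 \<Longrightarrow> norm (Y (q_param (- 1 / z))) * norm z ^ j = norm (Y (q_param z))"
  shows False
proof -
  \<comment> \<open>This is the modulus of \<open>q_param z\<close> on the line Im z = 1/2.\<close>
  define \<rho> where "\<rho> = exp (- pi)"
  have \<rho>: "\<rho> > 0" "\<rho> < 1" by (simp_all add: \<rho>_def)
  have cont: "continuous_on (cball 0 \<rho>) Y"
    using \<rho> by (intro holomorphic_on_imp_continuous_on holomorphic_on_subset[OF Y(1)]) auto
  have "continuous_on (sphere 0 \<rho>) (\<lambda>q. norm (Y q))"
    by (intro continuous_on_norm continuous_on_subset[OF cont]) auto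
  moreover have "sphere (0 :: complex) \<rho> \<noteq> {}" using \<rho> by simp
  ultimately obtain q0 where q0: "q0 \<in> sphere 0 \<rho>" "\<And>q. q \<in> sphere 0 \<rho> \<Longrightarrow> norm (Y q) \<le> norm (Y q0)"
    using continuous_attains_sup[of "sphere 0 \<rho>" "\<lambda>q. norm (Y q)"] by auto
  have max: "norm (Y q) \<le> norm (Y q0)" if "q \<in> cball 0 \<rho>" for q
  proof (rule maximum_modulus_frontier[of Y "cball 0 \<rho>"])
    show "Y holomorphic_on interior (cball 0 \<rho>)"
      using \<rho> by (intro holomorphic_on_subset[OF Y(1)]) auto
  qed (use cont q0 that in auto)
  have nq0: "norm q0 = \<rho>" "q0 \<noteq> 0" using q0(1) \<rho> by auto
  define z where "z = Ln q0 / (2 * of_real pi * \<i>)"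
  have qz: "q_param z = q0" using nq0 by (simp add: q_param_def z_def)
  have Re: "Re z = Im (Ln q0) / (2 * pi)" and Im: "Im z = 1 / 2"
    using nq0 by (simp_all add: z_def Re_divide Im_divide power2_eq_square \<rho>_def)
  have "\<bar>Im (Ln q0)\<bar> \<le> pi"
    using mpi_less_Im_Ln[of q0] Im_Ln_le_pi[of q0] nq0 by linarith
  hence "\<bar>Re z\<bar> \<le> 1 / 2" unfolding Re by (simp add: field_simps)
  hence "\<bar>Re z\<bar> ^ 2 \<le> (1 / 2) ^ 2" by (intro power_mono) auto
  hence "(Re z)\<^sup>2 + (Im z)\<^sup>2 \<le> 1 / 2" by (simp add: Im power2_eq_square)
  hence nz: "(norm z)\<^sup>2 \<le> 1 / 2" by (simp add: cmod_power2)
  hence "norm z < 1" by (intro power2_less_imp_less[of _ 1]) auto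
  hence less: "norm z ^ j < 1" using j by (intro power_less_one_iff[THEN iffD2]) auto
  have z0: "(norm z)\<^sup>2 > 0" using Im by auto
  have "Im (- 1 / z) = (1 / 2) / (norm z)\<^sup>2"
    by (simp add: Im_divide Im cmod_power2)
  also have "\<dots> \<ge> 1 / 2" using nz z0 by (simp add: field_simps)
  finally have "q_param (- 1 / z) \<in> cball 0 \<rho>"
    using mult_left_mono[of "1 / 2" "Im (- 1 / z)" "2 * pi"] by (simp add: norm_q_param \<rho>_def del: divide_minus_left)
  from max[OF this] have "norm (Y q0) \<le> norm (Y q0) * norm z ^ j"
    using inv[of z] Im qz mult_right_mono[of "norm (Y (q_param (- 1 / z)))" "norm (Y q0)" "norm z ^ j"] by auto
  hence "norm (Y q0) * (1 - norm z ^ j) \<le> 0" by (simp add: right_diff_distrib)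
  with less have "norm (Y q0) = 0" by (simp add: mult_le_0_iff)
  with max[of 0] \<rho> Y(2) show False by simp
qed

text \<open>In W / Delta^N the powers of q cancel, leaving U / \<open>Delta_hat\<close>^N:
  holomorphic on the disc as \<open>Delta_hat\<close> has no zeros, nonzero at the cusp, and of
  weight k - 12 N.\<close>

lemma valence_inequality:
  assumes U: "U holomorphic_on ball 0 1" "U 0 \<noteq> 0"
  assumes W: "\<And>z. Im z > 0 \<Longrightarrow> W z = q_param z ^ N * U (q_param z)"
  assumes mod: "\<And>z. Im z > 0 \<Longrightarrow> W (- 1 / z) = z powi k * W z"
  shows "12 * int N \<le> k"
proof (rule ccontr)
  assume "\<not> 12 * int N \<le> k"
  define j where "j = nat (12 * int N - k)"
  have j: "j > 0" "int j = 12 * int N - k" using \<open>\<not> 12 * int N \<le> k\<close> by (simp_all add: j_def)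
  define Y where "Y = (\<lambda>q. U q / Delta_hat q ^ N)"
  have Yq: "Y (q_param z) = W z / Delta z ^ N" if "Im z > 0" for z
    using that by (simp add: Y_def W Delta_def power_mult_distrib q_param_def)
  show False
  proof (rule no_negative_weight[of Y j])
    show "Y holomorphic_on ball 0 1"
      unfolding Y_def by (intro holomorphic_intros U Delta_hat_holomorphic) (simp add: Delta_hat_nonzero)
    show "Y 0 \<noteq> 0" using U by (simp add: Y_def Delta_hat_nonzero)
    fix z :: complex assume z: "Im z > 0"
    hence z0: "z \<noteq> 0" by auto
    have "Y (q_param (- 1 / z)) * z ^ j = z powi k * z ^ j * W z / (z ^ (12 * N) * Delta z ^ N)"
      unfolding Yq[OF Im_neg_inverse_pos[OF z]] mod[OF z] Delta_transformation[OF z]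
      by (simp add: power_mult_distrib power_mult)
    also have "z powi k * z ^ j = z powi (k + int j)"
      using z0 by (simp add: power_int_add)
    also have "\<dots> = z ^ (12 * N)"
      unfolding j by (simp flip: power_int_of_nat)
    finally have "Y (q_param (- 1 / z)) * z ^ j = Y (q_param z)"
      using z0 by (simp add: Yq[OF z])
    thus "norm (Y (q_param (- 1 / z))) * norm z ^ j = norm (Y (q_param z))"
      by (metis norm_mult norm_power)
  qed (rule j)
qed

section \<open>The Wronskian\<close>

text \<open>
  Up to \<open>z powi (w - r)\<close>, the vector \<open>(g\<^sub>0, \<dots>, g\<^sub>r)\<close> is transformed under \<open>z \<mapsto> -1/z\<close> by this triangular matrix.
\<close>
definition slash_coeff :: "nat \<Rightarrow> nat \<Rightarrow> nat \<Rightarrow> complex \<Rightarrow> complex" where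
  "slash_coeff r l m z =
     (if l \<le> m then of_nat ((r - l) choose (m - l)) * z powi (int r - int l - int m) else 0)"

lemma slash_coeff_diagonal: "slash_coeff r l l z = z powi (int r - 2 * int l)"
proof -
  have "int r - int l - int l = int r - 2 * int l" by simp
  thus ?thesis by (simp only: slash_coeff_def) simp
qed

text \<open>Entrywise form of z^2 S' = z^2 S N - N S for S = \<open>slash_coeff r\<close>, where N
  has the entries k in position (k, k - 1). On and above the diagonal it reduces to Pascal's rule
  and the absorption identity; just below, the two right-hand terms cancel.\<close>

lemma slash_coeff_derivative_identity:
  assumes z: "z \<noteq> 0" and lm: "l \<le> r" "m \<le> r"
  obtains D where "(slash_coeff r l m has_field_derivative D) (at z)"
    and "z ^ 2 * D = z ^ 2 * of_nat (Suc m) * slash_coeff r l (Suc m) z - of_nat l * slash_coeff r (l - 1) m z"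
proof (cases "l \<le> m")
  case False
  have 1: "(slash_coeff r l m has_field_derivative 0) (at z)"
    using False by (simp add: slash_coeff_def [abs_def])
  have 2: "z ^ 2 * of_nat (Suc m) * slash_coeff r l (Suc m) z = of_nat l * slash_coeff r (l - 1) m z"
  proof (cases "l = Suc m")
    case True
    have "z ^ 2 * z powi (int r - int l - int (Suc m)) = z powi (int r - int (l - 1) - int m)"
      using z True by (simp add: power_int_add [symmetric] flip: power_int_numeral)
    thus ?thesis using True by (simp add: slash_coeff_def)
  qed (use False in \<open>auto simp: slash_coeff_def\<close>)
  show thesis by (rule that[OF 1]) (simp only: 2 mult_zero_right diff_self)
next
  case True
  define a where "a = r - l"
  define b where "b = m - l"
  define e where "e = int r - int l - int m"
  define D where "D = of_nat (a choose b) * (of_int e * z powi (e - 1))"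
  have ab: "r = a + l" "m = b + l" "b \<le> a" using lm True by (auto simp: a_def b_def)
  have "2 + (e - 1) = e + 1" by simp
  moreover have "z powi (2 + (e - 1)) = z powi 2 * z powi (e - 1)"
    using z by (intro power_int_add) auto
  ultimately have zz: "z ^ 2 * z powi (e - 1) = z powi (e + 1)"
    by (simp only: power_int_numeral)
  have "(slash_coeff r l m has_field_derivative D) (at z)"
    unfolding slash_coeff_def [abs_def] D_def using True z
    by (auto intro!: derivative_eq_intros simp: a_def b_def e_def)
  moreover have "z ^ 2 * D = z ^ 2 * of_nat (Suc m) * slash_coeff r l (Suc m) z - of_nat l * slash_coeff r (l - 1) m z"
  proof -
    have abs: "(a - b) * (a choose b) = Suc b * (a choose Suc b)"
      using binomial_absorb_comp[of a b] binomial_absorption[of b a] by simp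
    have abs': "(of_nat a - of_nat b) * of_nat (a choose b) = (of_nat b + 1) * (of_nat (a choose Suc b) :: complex)"
      using arg_cong[OF abs, of "of_nat :: nat \<Rightarrow> complex"] ab(3) by (simp add: of_nat_diff distrib_right add.commute)
    have 1: "slash_coeff r l (Suc m) z = of_nat (a choose Suc b) * z powi (e - 1)"
      using True by (simp add: slash_coeff_def a_def b_def e_def Suc_diff_le algebra_simps)
    have 2: "of_nat l * slash_coeff r (l - 1) m z = of_nat l * of_nat (Suc a choose Suc b) * z powi (e + 1)"
    proof (cases "l = 0")
      case False
      hence "r - (l - 1) = Suc a" "m - (l - 1) = Suc b" "int r - int (l - 1) - int m = e + 1"
        by (auto simp: ab e_def)
      moreover have "l - 1 \<le> m" using True by simp
      ultimately show ?thesis by (simp add: slash_coeff_def del: binomial_Suc_Suc)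
    qed auto
    have "of_nat (a choose b) * of_int e - (of_nat m + 1) * of_nat (a choose Suc b) +
            of_nat l * of_nat (Suc a choose Suc b) = (0 :: complex)"
      using abs' unfolding e_def by (simp add: ab algebra_simps)
    hence "z ^ 2 * z powi (e - 1) * (of_nat (a choose b) * of_int e - (of_nat m + 1) * of_nat (a choose Suc b) +
            of_nat l * of_nat (Suc a choose Suc b)) = 0"
      by simp
    thus ?thesis unfolding 2 1 D_def zz [symmetric]
      by (simp add: algebra_simps del: binomial_Suc_Suc)
  qed
  ultimately show thesis by (rule that)
qed

text \<open>Isolates what the Wronskian argument needs: leading q-powers with nonvanishing cofactors
  \<open>u\<close> on the disc, and the behaviour under z -> -1/z. Neither E2 nor the forms h_l
  occur any more.\<close>

locale quasimodular_system =
  fixes r :: nat and w :: int and lam :: "nat \<Rightarrow> nat" and u g :: "nat \<Rightarrow> complex \<Rightarrow> complex"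
  assumes u_holomorphic: "k \<le> r \<Longrightarrow> u k holomorphic_on ball 0 1"
    and u_0: "k \<le> r \<Longrightarrow> u k 0 \<noteq> 0"
    and lam_Suc: "k < r \<Longrightarrow> lam (Suc k) \<le> lam k"
    and g_eq: "k \<le> r \<Longrightarrow> Im z > 0 \<Longrightarrow> g k z = q_param z ^ lam k * u k (q_param z)"
    and g_slash: "l \<le> r \<Longrightarrow> Im z > 0 \<Longrightarrow>
      g l (- 1 / z) = z powi (w - int r) * (\<Sum>m\<le>r. slash_coeff r l m z * g m z)"
begin

abbreviation exponent :: "nat \<Rightarrow> complex" where
  "exponent k \<equiv> 2 * of_real pi * \<i> * of_nat (lam k)"

text \<open>
  With \<open>f\<^sub>k = \<Sum>l\<le>k. (k choose l) * z ^ (k - l) * g\<^sub>l\<close>, the matrix of the \<open>G i k\<close> is a unitriangular multiple of the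
  Wronskian matrix of \<open>f\<^sub>0, \<dots>, f\<^sub>r\<close>, where the \<open>i\<close>-th derivative is replaced by the product of the operators
  \<open>d/dz - exponent j\<close> for \<open>j < i\<close>. This choice makes the leading coefficients \<open>Ghat i k 0\<close> triangular.
  For \<open>k = 0\<close> the factor \<open>of_nat k\<close> removes the meaningless term with index \<open>k - 1\<close>.
\<close>
primrec G :: "nat \<Rightarrow> nat \<Rightarrow> complex \<Rightarrow> complex" where
  "G 0 = g"
| "G (Suc i) = (\<lambda>k z. deriv (G i k) z - exponent i * G i k z + of_nat k * G i (k - 1) z)"

primrec Ghat :: "nat \<Rightarrow> nat \<Rightarrow> complex \<Rightarrow> complex" where
  "Ghat 0 = u"
| "Ghat (Suc i) = (\<lambda>k q. 2 * of_real pi * \<i> * q * deriv (Ghat i k) q + (exponent k - exponent i) * Ghat i k q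
     + of_nat k * q ^ (lam (k - 1) - lam k) * Ghat i (k - 1) q)"

section \<open>The matrix at the cusp\<close>

lemma lam_antimono: "j \<le> k \<Longrightarrow> k \<le> r \<Longrightarrow> lam k \<le> lam j"
proof (induction k rule: dec_induct)
  case (step n)
  thus ?case using lam_Suc[of n] by simp
qed auto

lemma Ghat_holomorphic: "k \<le> r \<Longrightarrow> Ghat i k holomorphic_on ball 0 1"
  by (induction i arbitrary: k) (auto intro!: holomorphic_intros u_holomorphic)

lemma G_eq:
  "k \<le> r \<Longrightarrow> Im z > 0 \<Longrightarrow> G i k z = q_param z ^ lam k * Ghat i k (q_param z)"
proof (induction i arbitrary: k z)
  case (Suc i)
  define q where "q = q_param z"
  have q: "q \<in> ball 0 1" using norm_q_param_less_1[OF Suc.prems(2)] by (simp add: q_def)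
  have "(Ghat i k has_field_derivative deriv (Ghat i k) q) (at q)"
    using Ghat_holomorphic[OF Suc.prems(1)] q by (intro holomorphic_derivI) auto
  note D = DERIV_chain2[OF this[unfolded q_def] q_param_has_field_derivative[of z UNIV]]
  have "((\<lambda>z. q_param z ^ lam k * Ghat i k (q_param z)) has_field_derivative
      (exponent k * q ^ lam k * Ghat i k q + q ^ lam k * (deriv (Ghat i k) q * (2 * of_real pi * \<i> * q)))) (at z)"
    by (rule derivative_eq_intros refl D q_param_has_field_derivative)+
       (cases "lam k", auto simp: q_def algebra_simps)
  moreover have "eventually (\<lambda>z. G i k z = q_param z ^ lam k * Ghat i k (q_param z)) (nhds z)"
    using eventually_nhds_in_open[OF open_halfspace_Im_gt[of 0], of z] Suc.prems
    by (auto elim!: eventually_mono intro: Suc.IH)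
  ultimately have "(G i k has_field_derivative
      (exponent k * q ^ lam k * Ghat i k q + q ^ lam k * (deriv (Ghat i k) q * (2 * of_real pi * \<i> * q)))) (at z)"
    by (subst DERIV_cong_ev[OF refl _ refl])
  hence d: "deriv (G i k) z =
      exponent k * q ^ lam k * Ghat i k q + q ^ lam k * (deriv (Ghat i k) q * (2 * of_real pi * \<i> * q))"
    by (rule DERIV_imp_deriv)
  \<comment> \<open>The natural-number difference of exponents is a true one because
    \<open>lam\<close> decreases; for \<open>k = 0\<close> both sides vanish through
    \<open>of_nat k\<close>.\<close>
  have e: "of_nat k * G i (k - 1) z = q ^ lam k * (of_nat k * q ^ (lam (k - 1) - lam k) * Ghat i (k - 1) q)"
  proof (cases k)
    case (Suc k')
    have "q ^ lam (k - 1) = q ^ lam k * q ^ (lam (k - 1) - lam k)"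
      using lam_antimono[of "k - 1" k] Suc.prems by (simp flip: power_add)
    thus ?thesis using Suc.IH[of "k - 1" z] Suc.prems by (simp add: q_def)
  qed auto
  show ?case
    unfolding G.simps d e Suc.IH[OF Suc.prems] by (simp add: algebra_simps flip: q_def)
qed (simp add: g_eq)

lemma G_holomorphic:
  assumes "k \<le> r"
  shows "G i k holomorphic_on {z. Im z > 0}"
proof -
  have "(\<lambda>z. q_param z ^ lam k * Ghat i k (q_param z)) holomorphic_on {z. Im z > 0}"
  proof (intro holomorphic_intros)
    show q: "q_param holomorphic_on {z. Im z > 0}"
      unfolding q_param_def [abs_def] by (intro holomorphic_intros)
    show "(\<lambda>z. Ghat i k (q_param z)) holomorphic_on {z. Im z > 0}"
      using holomorphic_on_compose_gen[OF q Ghat_holomorphic[OF assms]] norm_q_param_less_1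
      by (auto simp: o_def image_subset_iff)
  qed
  thus ?thesis using G_eq[OF assms] by (subst holomorphic_cong[OF refl]) auto
qed

text \<open>At q = 0 the derivative term drops out. Step i multiplies the entry k = i by
  \<open>exponent i - exponent i\<close>, and the contribution of k - 1 has already been
  eliminated.\<close>

lemma Ghat_0_above_diagonal: "k \<le> r \<Longrightarrow> k < i \<Longrightarrow> Ghat i k 0 = 0"
proof (induction i arbitrary: k)
  case (Suc i)
  show ?case
  proof (cases "k = i")
    case True
    thus ?thesis using Suc by (cases k) auto
  next
    case False
    thus ?thesis using Suc.IH[of k] Suc.IH[of "k - 1"] Suc.prems by simp
  qed
qed auto

text \<open>If two neighbouring exponents agree, the new diagonal entry is \<open>Suc k\<close>
  times the previous one, since 0^0 = 1. If they differ, the coupling to row k vanishes at q = 0 and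
  the entry is \<open>u (Suc k) 0\<close> times nonzero differences of exponents.\<close>

lemma Ghat_0_diagonal: "k \<le> r \<Longrightarrow> Ghat k k 0 \<noteq> 0"
proof (induction k)
  case 0
  thus ?case by (simp add: u_0)
next
  case (Suc k)
  show ?case
  proof (cases "lam k = lam (Suc k)")
    case True
    thus ?thesis using Suc by (simp del: of_nat_Suc)
  next
    case False
    hence less: "lam (Suc k) < lam k" using lam_Suc[of k] Suc.prems by simp
    have *: "Ghat i (Suc k) 0 \<noteq> 0" if "i \<le> Suc k" for i
      using that
    proof (induction i)
      case 0
      thus ?case using u_0[OF Suc.prems] by simp
    next
      case (Suc i)
      have "lam (Suc k) < lam i"
        using less lam_antimono[of i k] \<open>Suc k \<le> r\<close> Suc.prems by simp
      thus ?case using Suc less by (simp add: zero_power)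
    qed
    thus ?thesis by blast
  qed
qed

definition Gmat :: "complex \<Rightarrow> complex mat" where
  "Gmat z = mat (Suc r) (Suc r) (\<lambda>(k, i). G i k z)"

definition Ghat_mat :: "complex \<Rightarrow> complex mat" where
  "Ghat_mat q = mat (Suc r) (Suc r) (\<lambda>(k, i). Ghat i k q)"

lemma det_mat_expansion:
  "det (mat n n (\<lambda>(k, i). f i k :: 'a :: comm_ring_1)) =
     (\<Sum>p | p permutes {0..<n}. signof p * (\<Prod>k = 0..<n. f (p k) k))"
proof -
  have "p k < n" if "p permutes {0..<n}" "k < n" for p k
    using permutes_in_image[OF that(1), of k] that(2) by simp
  thus ?thesis by (subst det_def'[of _ n]) (auto intro!: sum.cong prod.cong)
qed

lemma det_Ghat_mat:
  "det (Ghat_mat q) = (\<Sum>p | p permutes {0..<Suc r}. signof p * (\<Prod>k = 0..<Suc r. Ghat (p k) k q))"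
  unfolding Ghat_mat_def by (rule det_mat_expansion)

lemma det_Gmat:
  assumes "Im z > 0"
  shows "det (Gmat z) = q_param z ^ (\<Sum>k\<le>r. lam k) * det (Ghat_mat (q_param z))"
proof -
  have "det (Gmat z) = (\<Sum>p | p permutes {0..<Suc r}. signof p * (\<Prod>k = 0..<Suc r. G (p k) k z))"
    unfolding Gmat_def by (rule det_mat_expansion)
  also have "\<dots> = (\<Sum>p | p permutes {0..<Suc r}. signof p * (\<Prod>k = 0..<Suc r. q_param z ^ lam k * Ghat (p k) k (q_param z)))"
    using assms by (intro sum.cong prod.cong arg_cong2[where f = "(*)"] refl G_eq) auto
  also have "\<dots> = (\<Prod>k = 0..<Suc r. q_param z ^ lam k) * det (Ghat_mat (q_param z))"
    by (simp only: prod.distrib det_Ghat_mat sum_distrib_left mult_ac)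
  also have "{0..<Suc r} = {..r}" by auto
  finally show ?thesis by (simp add: power_sum)
qed

lemma det_Ghat_mat_holomorphic: "(\<lambda>q. det (Ghat_mat q)) holomorphic_on ball 0 1"
  unfolding det_Ghat_mat by (intro holomorphic_intros Ghat_holomorphic) auto

lemma det_Ghat_mat_0: "det (Ghat_mat 0) \<noteq> 0"
proof -
  have "det (Ghat_mat 0) = prod_list (diag_mat (Ghat_mat 0))"
    by (rule det_lower_triangular[of "Suc r"]) (auto simp: Ghat_mat_def Ghat_0_above_diagonal)
  also have "\<dots> = (\<Prod>k = 0..<Suc r. Ghat k k 0)"
    unfolding prod_list_diag_prod by (intro prod.cong) (auto simp: Ghat_mat_def)
  also have "\<dots> \<noteq> 0"
    using Ghat_0_diagonal by (subst prod_zero_iff) auto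
  finally show ?thesis .
qed

section \<open>The matrix under z -> -1/z\<close>

definition T :: "nat \<Rightarrow> nat \<Rightarrow> complex \<Rightarrow> complex" where
  "T l j z = (\<Sum>m\<le>r. slash_coeff r l m z * G j m z)"

text \<open>Coefficients expressing the columns of \<open>Gmat (- 1 / z)\<close> by those of S times
  \<open>Gmat z\<close>. Differentiation at -1/z is z^2 d/dz, so the product rule gives the three
  terms in the bracket; no trace of N remains, since it commutes past S.\<close>

primrec c :: "nat \<Rightarrow> nat \<Rightarrow> complex \<Rightarrow> complex" where
  "c 0 = (\<lambda>j z. if j = 0 then z powi (w - int r) else 0)"
| "c (Suc i) = (\<lambda>j z. z ^ 2 * (deriv (c i j) z + (if j = 0 then 0 else c i (j - 1) z) + exponent j * c i j z)
     - exponent i * c i j z)"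

lemma c_holomorphic: "c i j holomorphic_on {z. Im z > 0}"
proof (induction i arbitrary: j)
  case 0
  show ?case by (cases "j = 0") (auto intro!: holomorphic_intros)
next
  case (Suc i)
  show ?case using Suc by (cases "j = 0") (auto intro!: holomorphic_intros open_halfspace_Im_gt)
qed

lemma c_above: "i < j \<Longrightarrow> c i j = (\<lambda>_. 0)"
  by (induction i arbitrary: j) auto

lemma c_diagonal: "z \<noteq> 0 \<Longrightarrow> c i i z = z powi (w - int r + 2 * int i)"
proof (induction i)
  case (Suc i)
  have "z ^ 2 * z powi (w - int r + 2 * int i) = z powi (w - int r + 2 * int (Suc i))"
    using Suc.prems by (simp add: power_int_add [symmetric] algebra_simps flip: power_int_numeral)
  thus ?case using Suc by (simp add: c_above)
qed auto

text \<open>For a vector G this is (z^2 d/dz + N)(S G) = z^2 S (d/dz + N) G, a consequence of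
  \<open>slash_coeff_derivative_identity\<close>.\<close>

lemma T_has_field_derivative:
  assumes l: "l \<le> r" and z: "Im z > 0"
  obtains D where "(T l j has_field_derivative D) (at z)"
    and "z ^ 2 * D = z ^ 2 * (T l (Suc j) z + exponent j * T l j z) - of_nat l * T (l - 1) j z"
proof -
  have z0: "z \<noteq> 0" using z by auto
  have "\<exists>D. (slash_coeff r l m has_field_derivative D) (at z) \<and>
    z ^ 2 * D = z ^ 2 * of_nat (Suc m) * slash_coeff r l (Suc m) z - of_nat l * slash_coeff r (l - 1) m z"
    if "m \<le> r" for m
    using slash_coeff_derivative_identity[OF z0 l that] by metis
  then obtain d where d: "\<And>m. m \<le> r \<Longrightarrow> (slash_coeff r l m has_field_derivative d m) (at z)"
    "\<And>m. m \<le> r \<Longrightarrow> z ^ 2 * d m = z ^ 2 * of_nat (Suc m) * slash_coeff r l (Suc m) z - of_nat l * slash_coeff r (l - 1) m z"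
    by metis
  define D where "D = (\<Sum>m\<le>r. d m * G j m z + slash_coeff r l m z * deriv (G j m) z)"
  have "(T l j has_field_derivative D) (at z)"
    unfolding T_def [abs_def] D_def
  proof (rule DERIV_sum)
    fix m assume m: "m \<in> {..r}"
    have "(G j m has_field_derivative deriv (G j m) z) (at z)"
      using G_holomorphic[of m j] m z by (intro holomorphic_derivI[OF _ open_halfspace_Im_gt]) auto
    from DERIV_mult[OF d(1) this] m
    show "((\<lambda>z. slash_coeff r l m z * G j m z) has_field_derivative
            d m * G j m z + slash_coeff r l m z * deriv (G j m) z) (at z)" by (simp add: mult.commute)
  qed
  moreover have "z ^ 2 * D = z ^ 2 * (T l (Suc j) z + exponent j * T l j z) - of_nat l * T (l - 1) j z"
  proof -
    \<comment> \<open>The extra index \<open>Suc r\<close> does no harm: its binomial coefficient (r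
      - l choose r + 1 - l) is 0.\<close>
    have shift: "(\<Sum>m\<le>r. of_nat m * slash_coeff r l m z * G j (m - 1) z) =
                 (\<Sum>m\<le>r. of_nat (Suc m) * slash_coeff r l (Suc m) z * G j m z)"
    proof -
      have "slash_coeff r l (Suc r) z = 0" using l by (simp add: slash_coeff_def Suc_diff_le)
      hence "(\<Sum>m\<le>r. of_nat m * slash_coeff r l m z * G j (m - 1) z) =
             (\<Sum>m\<le>Suc r. of_nat m * slash_coeff r l m z * G j (m - 1) z)" by simp
      also have "\<dots> = (\<Sum>m\<le>r. of_nat (Suc m) * slash_coeff r l (Suc m) z * G j m z)"
        by (subst sum.atMost_Suc_shift) simp
      finally show ?thesis .
    qed
    have "z ^ 2 * D = (\<Sum>m\<le>r. z ^ 2 * d m * G j m z) +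
            (\<Sum>m\<le>r. z ^ 2 * (slash_coeff r l m z * (G (Suc j) m z + exponent j * G j m z)))
            - z ^ 2 * (\<Sum>m\<le>r. of_nat m * slash_coeff r l m z * G j (m - 1) z)"
      by (simp add: D_def sum_distrib_left algebra_simps flip: sum.distrib sum_subtractf)
    also have "(\<Sum>m\<le>r. z ^ 2 * (slash_coeff r l m z * (G (Suc j) m z + exponent j * G j m z))) =
               z ^ 2 * (T l (Suc j) z + exponent j * T l j z)"
      by (simp add: T_def sum_distrib_left algebra_simps flip: sum.distrib)
    also have "(\<Sum>m\<le>r. z ^ 2 * d m * G j m z) =
        (\<Sum>m\<le>r. (z ^ 2 * of_nat (Suc m) * slash_coeff r l (Suc m) z - of_nat l * slash_coeff r (l - 1) m z) * G j m z)"
      by (intro sum.cong refl) (simp only: d(2) atMost_iff)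
    also have "\<dots> = z ^ 2 * (\<Sum>m\<le>r. of_nat (Suc m) * slash_coeff r l (Suc m) z * G j m z) - of_nat l * T (l - 1) j z"
      by (simp add: T_def sum_distrib_left left_diff_distrib right_diff_distrib sum_subtractf mult_ac del: of_nat_Suc)
    finally show ?thesis unfolding shift by simp
  qed
  ultimately show thesis by (rule that)
qed

text \<open>Differentiating the induction hypothesis produces -l times the sum of the
  \<open>c i j z * T (l - 1) j z\<close>. This cancels exactly against the coupling term
  \<open>of_nat l * G i (l - 1)\<close> at -1/z, and what is left is the recursion of
  \<open>c\<close>.\<close>

lemma G_slash:
  "l \<le> r \<Longrightarrow> Im z > 0 \<Longrightarrow> G i l (- 1 / z) = (\<Sum>j\<le>i. c i j z * T l j z)"
proof (induction i arbitrary: l z)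
  case 0
  from g_slash[OF this] show ?case by (simp add: T_def)
next
  case (Suc i)
  have z0: "z \<noteq> 0" using Suc.prems by auto
  have "\<exists>D. (T l j has_field_derivative D) (at z) \<and>
     z ^ 2 * D = z ^ 2 * (T l (Suc j) z + exponent j * T l j z) - of_nat l * T (l - 1) j z" for j
    using T_has_field_derivative[OF Suc.prems] by metis
  then obtain D where D: "\<And>j. (T l j has_field_derivative D j) (at z)"
    "\<And>j. z ^ 2 * D j = z ^ 2 * (T l (Suc j) z + exponent j * T l j z) - of_nat l * T (l - 1) j z"
    by metis
  have c: "(c i j has_field_derivative deriv (c i j) z) (at z)" for j
    using c_holomorphic Suc.prems by (intro holomorphic_derivI[OF _ open_halfspace_Im_gt]) auto
  have "((\<lambda>z. \<Sum>j\<le>i. c i j z * T l j z) has_field_derivative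
          (\<Sum>j\<le>i. deriv (c i j) z * T l j z + c i j z * D j)) (at z)"
    by (rule DERIV_sum) (use DERIV_mult[OF c D(1)] in \<open>simp add: mult.commute\<close>)
  moreover have "eventually (\<lambda>z. Im z > 0) (nhds z)"
    using eventually_nhds_in_open[OF open_halfspace_Im_gt[of 0], of z] Suc.prems by simp
  hence "eventually (\<lambda>z. G i l (- 1 / z) = (\<Sum>j\<le>i. c i j z * T l j z)) (nhds z)"
    by eventually_elim (rule Suc.IH[OF Suc.prems(1)])
  ultimately have "((\<lambda>z. G i l (- 1 / z)) has_field_derivative
          (\<Sum>j\<le>i. deriv (c i j) z * T l j z + c i j z * D j)) (at z)"
    by (subst DERIV_cong_ev[OF refl _ refl])
  moreover have "((\<lambda>z. G i l (- 1 / z)) has_field_derivative deriv (G i l) (- 1 / z) * (1 / z ^ 2)) (at z)"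
  proof (rule DERIV_chain2[where f = "G i l" and g = "\<lambda>z. - 1 / z"])
    show "(G i l has_field_derivative deriv (G i l) (- 1 / z)) (at (- 1 / z))"
      using G_holomorphic[OF Suc.prems(1)] Im_neg_inverse_pos[OF Suc.prems(2)]
      by (intro holomorphic_derivI[OF _ open_halfspace_Im_gt[of 0]]) auto
    show "((\<lambda>z. - 1 / z) has_field_derivative 1 / z ^ 2) (at z)"
      using z0 by (auto intro!: derivative_eq_intros simp: power2_eq_square)
  qed
  ultimately have "deriv (G i l) (- 1 / z) * (1 / z ^ 2) = (\<Sum>j\<le>i. deriv (c i j) z * T l j z + c i j z * D j)"
    by (rule DERIV_unique [symmetric])
  hence "deriv (G i l) (- 1 / z) = z ^ 2 * (\<Sum>j\<le>i. deriv (c i j) z * T l j z + c i j z * D j)"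
    using z0 by (simp add: field_simps)
  also have "\<dots> = (\<Sum>j\<le>i. z ^ 2 * deriv (c i j) z * T l j z + c i j z * (z ^ 2 * D j))"
    by (simp add: sum_distrib_left algebra_simps)
  also have "\<dots> = (\<Sum>j\<le>i. (z ^ 2 * (deriv (c i j) z + exponent j * c i j z)) * T l j z) +
      (\<Sum>j\<le>i. z ^ 2 * c i j z * T l (Suc j) z) - of_nat l * (\<Sum>j\<le>i. c i j z * T (l - 1) j z)"
    unfolding D(2) by (simp add: sum_distrib_left algebra_simps flip: sum.distrib sum_subtractf)
  finally have d: "deriv (G i l) (- 1 / z) = \<dots>" .
  have IH: "G i l (- 1 / z) = (\<Sum>j\<le>i. c i j z * T l j z)" "G i (l - 1) (- 1 / z) = (\<Sum>j\<le>i. c i j z * T (l - 1) j z)"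
    by (rule Suc.IH; use Suc.prems in simp)+
  have "G (Suc i) l (- 1 / z) =
      (\<Sum>j\<le>i. (z ^ 2 * (deriv (c i j) z + exponent j * c i j z) - exponent i * c i j z) * T l j z) +
      (\<Sum>j\<le>i. z ^ 2 * c i j z * T l (Suc j) z)"
    unfolding G.simps d IH by (simp add: sum_distrib_left algebra_simps flip: sum.distrib sum_subtractf)
  also have "(\<Sum>j\<le>i. (z ^ 2 * (deriv (c i j) z + exponent j * c i j z) - exponent i * c i j z) * T l j z) =
      (\<Sum>j\<le>Suc i. (z ^ 2 * (deriv (c i j) z + exponent j * c i j z) - exponent i * c i j z) * T l j z)"
    by (simp add: c_above)
  also have "(\<Sum>j\<le>i. z ^ 2 * c i j z * T l (Suc j) z) =
      (\<Sum>j\<le>Suc i. z ^ 2 * (if j = 0 then 0 else c i (j - 1) z) * T l j z)"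
    by (subst sum.atMost_Suc_shift) simp
  finally show ?case
    by (simp add: algebra_simps flip: sum.distrib)
qed

text \<open>The matrix is multiplied by S on the left and by C on the right, both upper triangular.
  Their l-th diagonal entries multiply to z^(r - 2l) z^(w - r + 2l) = z^w, once for each of the r +
  1 indices.\<close>

lemma det_Gmat_slash:
  assumes z: "Im z > 0"
  shows "det (Gmat (- 1 / z)) = z powi (w * (int r + 1)) * det (Gmat z)"
proof -
  have z0: "z \<noteq> 0" using z by auto
  define n where "n = Suc r"
  define S where "S = mat n n (\<lambda>(l, m). slash_coeff r l m z)"
  define C where "C = mat n n (\<lambda>(j, i). c i j z)"
  have carr: "S \<in> carrier_mat n n" "C \<in> carrier_mat n n" "Gmat z \<in> carrier_mat n n"
    by (auto simp: S_def C_def Gmat_def n_def)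
  have set: "{0..<n} = {..r}" by (auto simp: n_def)
  have "Gmat (- 1 / z) = S * Gmat z * C"
  proof (rule eq_matI)
    fix l i assume "l < dim_row (S * Gmat z * C)" "i < dim_col (S * Gmat z * C)"
    hence li: "l < n" "i < n" by (auto simp: S_def C_def)
    have T: "(S * Gmat z) $$ (l, j) = T l j z" if "j < n" for j
      unfolding T_def set [symmetric] using li that
      by (auto simp: S_def Gmat_def scalar_prod_def intro!: sum.cong simp flip: n_def)
    have "(S * Gmat z * C) $$ (l, i) = (\<Sum>j = 0..<n. T l j z * c i j z)"
      using li T by (simp add: S_def C_def Gmat_def scalar_prod_def flip: n_def)
    also have "\<dots> = (\<Sum>j\<le>i. c i j z * T l j z)"
      using li by (intro sum.mono_neutral_cong_right) (auto simp: c_above mult.commute)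
    also have "\<dots> = Gmat (- 1 / z) $$ (l, i)"
      using li z G_slash[of l z i] by (simp add: Gmat_def n_def)
    finally show "Gmat (- 1 / z) $$ (l, i) = (S * Gmat z * C) $$ (l, i)" ..
  qed (auto simp: S_def C_def Gmat_def n_def)
  hence "det (Gmat (- 1 / z)) = det S * det C * det (Gmat z)"
    using carr by (simp add: det_mult[of _ n])
  also have "det S = (\<Prod>l\<in>{..r}. z powi (int r - 2 * int l))"
  proof -
    have "det S = prod_list (diag_mat S)"
      by (rule det_upper_triangular[OF _ carr(1)]) (auto simp: S_def slash_coeff_def)
    also have "\<dots> = (\<Prod>l\<in>{..r}. z powi (int r - 2 * int l))"
      unfolding prod_list_diag_prod
      by (intro prod.cong) (auto simp: S_def slash_coeff_diagonal n_def)
    finally show ?thesis .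
  qed
  also have "det C = (\<Prod>l\<in>{..r}. z powi (w - int r + 2 * int l))"
  proof -
    have "det C = prod_list (diag_mat C)"
      by (rule det_upper_triangular[OF _ carr(2)]) (auto simp: C_def c_above)
    also have "\<dots> = (\<Prod>l\<in>{..r}. z powi (w - int r + 2 * int l))"
      unfolding prod_list_diag_prod using z0
      by (intro prod.cong) (auto simp: C_def c_diagonal n_def)
    finally show ?thesis .
  qed
  also have "(\<Prod>l\<in>{..r}. z powi (int r - 2 * int l)) * (\<Prod>l\<in>{..r}. z powi (w - int r + 2 * int l)) =
             (\<Prod>l\<in>{..r}. z powi w)"
    using z0 by (simp add: prod.distrib [symmetric] power_int_add [symmetric])
  also have "\<dots> = z powi (w * (int r + 1))"
    by (simp add: power_int_mult add.commute flip: power_int_of_nat)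
  finally show ?thesis .
qed

lemma sum_lam_le: "12 * int (\<Sum>k\<le>r. lam k) \<le> w * (int r + 1)"
proof (rule valence_inequality[OF det_Ghat_mat_holomorphic det_Ghat_mat_0])
  fix z :: complex assume "Im z > 0"
  thus "det (Gmat z) = q_param z ^ (\<Sum>k\<le>r. lam k) * det (Ghat_mat (q_param z))"
    and "det (Gmat (- 1 / z)) = z powi (w * (int r + 1)) * det (Gmat z)"
    by (rule det_Gmat det_Gmat_slash)+
qed

end

section \<open>Quasimodular forms\<close>

text \<open>Expanding (z^2 E2 + e z)^(n - l) with e = 6 / (pi i) and exchanging the sums, (n choose
  l) (n - l choose m - l) = (n choose m) (m choose l) reassembles the inner sum into g_m. The factor
  e^l in the normalisation absorbs all powers of e, and the factor (r choose l) turns the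
  coefficient into (r - l choose m - l).\<close>

lemma quasimodular_slash:
  fixes r :: nat and w :: int and h g :: "nat \<Rightarrow> complex \<Rightarrow> complex"
  assumes h: "\<And>l. l \<le> r \<Longrightarrow> h l \<in> modular_forms (w - 2 * int l)"
    and g: "\<And>l z. l \<le> r \<Longrightarrow> Im z > 0 \<Longrightarrow>
      of_nat (r choose l) * g l z =
        (6 / (of_real pi * \<i>)) ^ l *
        (\<Sum>m=0..r-l. of_nat ((l + m) choose m) * E2 z ^ m * h (l + m) z)"
    and l: "l \<le> r" and z: "Im z > 0"
  shows "g l (- 1 / z) = z powi (w - int r) * (\<Sum>m\<le>r. slash_coeff r l m z * g m z)"
proof -
  have z0: "z \<noteq> 0" using z by auto
  define e :: complex where "e = 6 / (of_real pi * \<i>)"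
  have h_slash: "h n (- 1 / z) = z powi (w - 2 * int n) * h n z" if "n \<le> r" for n
  proof -
    have "\<forall>a b c d :: int. a * d - b * c = 1 \<longrightarrow>
        (\<forall>z\<in>upper_half_plane. h n ((of_int a * z + of_int b) / (of_int c * z + of_int d)) =
             (of_int c * z + of_int d) powi (w - 2 * int n) * h n z)"
      using h[OF that] by (simp add: modular_forms_def)
    \<comment> \<open>The variables occur in the order a, d, b, c, so this is the matrix with rows
      (0, -1) and (1, 0).\<close>
    from this[rule_format, of 0 0 "-1" 1 z] z show ?thesis by (simp add: upper_half_plane_def)
  qed
  have g': "of_nat (r choose l) * g l z = e ^ l * (\<Sum>n=l..r. of_nat (n choose l) * E2 z ^ (n - l) * h n z)"
    if "l \<le> r" "Im z > 0" for l z
  proof -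
    have "(\<Sum>n=l..r. of_nat (n choose l) * E2 z ^ (n - l) * h n z) =
          (\<Sum>m=0..r-l. of_nat ((l + m) choose m) * E2 z ^ m * h (l + m) z)"
    proof (rule sum.reindex_bij_witness[of _ "\<lambda>m. l + m" "\<lambda>n. n - l"])
      fix n assume n: "n \<in> {l..r}"
      hence "n choose (n - l) = n choose l" by (intro binomial_symmetric [symmetric]) simp
      thus "of_nat ((l + (n - l)) choose (n - l)) * E2 z ^ (n - l) * h (l + (n - l)) z =
            of_nat (n choose l) * E2 z ^ (n - l) * h n z"
        using n by simp
    qed (use that(1) in auto)
    thus ?thesis using g[OF that] by (simp add: e_def)
  qed
  have step: "E2 (- 1 / z) ^ (n - l) * h n (- 1 / z) =
      z powi (w - int r) * (\<Sum>m=l..n. of_nat ((n - l) choose (m - l)) * e ^ (m - l) * z powi (int r - int l - int m)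
        * E2 z ^ (n - m)) * h n z" if "l \<le> n" "n \<le> r" for n
  proof -
    have "E2 (- 1 / z) ^ (n - l) = (e * z + z ^ 2 * E2 z) ^ (n - l)"
      unfolding E2_transformation[OF z] e_def by (simp only: add.commute)
    also have "\<dots> = (\<Sum>j\<le>n-l. of_nat ((n - l) choose j) * (e * z) ^ j * (z ^ 2 * E2 z) ^ (n - l - j))"
      by (rule binomial_ring)
    also have "\<dots> = (\<Sum>m=l..n. of_nat ((n - l) choose (m - l)) * (e * z) ^ (m - l) * (z ^ 2 * E2 z) ^ (n - m))"
      using that(1) by (intro sum.reindex_bij_witness[of _ "\<lambda>m. m - l" "\<lambda>j. l + j"]) auto
    finally have E: "E2 (- 1 / z) ^ (n - l) = \<dots>" .
    have "E2 (- 1 / z) ^ (n - l) * h n (- 1 / z) =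
      (\<Sum>m=l..n. of_nat ((n - l) choose (m - l)) * (e * z) ^ (m - l) * (z ^ 2 * E2 z) ^ (n - m) * z powi (w - 2 * int n)) * h n z"
      unfolding E h_slash[OF that(2)] by (simp only: sum_distrib_right mult.assoc)
    also have "(\<Sum>m=l..n. of_nat ((n - l) choose (m - l)) * (e * z) ^ (m - l) * (z ^ 2 * E2 z) ^ (n - m) * z powi (w - 2 * int n)) =
      (\<Sum>m=l..n. z powi (w - int r) * (of_nat ((n - l) choose (m - l)) * e ^ (m - l) * z powi (int r - int l - int m)
        * E2 z ^ (n - m)))"
    proof (rule sum.cong)
      fix m assume m: "m \<in> {l..n}"
      have "z ^ (m - l) * (z ^ 2) ^ (n - m) * z powi (w - 2 * int n) =
              z powi (int (m - l) + 2 * int (n - m) + (w - 2 * int n))"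
        using z0 by (simp add: power_int_add power_int_mult flip: power_mult)
      also have "int (m - l) + 2 * int (n - m) + (w - 2 * int n) = (w - int r) + (int r - int l - int m)"
        using m by (simp add: of_nat_diff)
      also have "z powi \<dots> = z powi (w - int r) * z powi (int r - int l - int m)"
        using z0 by (simp only: power_int_add simp_thms)
      finally have "z ^ (m - l) * (z ^ 2) ^ (n - m) * z powi (w - 2 * int n) =
         z powi (w - int r) * z powi (int r - int l - int m)" .
      hence "of_nat ((n - l) choose (m - l)) * e ^ (m - l) * E2 z ^ (n - m) * (z ^ (m - l) * (z ^ 2) ^ (n - m) * z powi (w - 2 * int n)) =
          of_nat ((n - l) choose (m - l)) * e ^ (m - l) * E2 z ^ (n - m) * (z powi (w - int r) * z powi (int r - int l - int m))"
        by simp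
      thus "of_nat ((n - l) choose (m - l)) * (e * z) ^ (m - l) * (z ^ 2 * E2 z) ^ (n - m) * z powi (w - 2 * int n) =
         z powi (w - int r) * (of_nat ((n - l) choose (m - l)) * e ^ (m - l) * z powi (int r - int l - int m) * E2 z ^ (n - m))"
        by (simp add: power_mult_distrib mult_ac)
    qed simp
    finally show ?thesis by (simp add: sum_distrib_left)
  qed
  have "of_nat (r choose l) * g l (- 1 / z) =
      e ^ l * (\<Sum>n=l..r. of_nat (n choose l) * (E2 (- 1 / z) ^ (n - l) * h n (- 1 / z)))"
    using g'[OF l Im_neg_inverse_pos[OF z]] by (simp add: mult.assoc)
  also have "\<dots> = z powi (w - int r) * (\<Sum>n=l..r. \<Sum>m=l..n. of_nat (n choose l) * of_nat ((n - l) choose (m - l))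
     * e ^ m * z powi (int r - int l - int m) * E2 z ^ (n - m) * h n z)"
    unfolding sum_distrib_left
  proof (rule sum.cong)
    fix n assume n: "n \<in> {l..r}"
    have "e ^ l * (of_nat (n choose l) * (E2 (- 1 / z) ^ (n - l) * h n (- 1 / z))) =
       e ^ l * (of_nat (n choose l) * (z powi (w - int r) * (\<Sum>m=l..n. of_nat ((n - l) choose (m - l)) *
          e ^ (m - l) * z powi (int r - int l - int m) * E2 z ^ (n - m)) * h n z))"
      using n by (subst step) auto
    also have "\<dots> = (\<Sum>m=l..n. e ^ l * (of_nat (n choose l) * (z powi (w - int r) * (of_nat ((n - l) choose (m - l)) *
          e ^ (m - l) * z powi (int r - int l - int m) * E2 z ^ (n - m)) * h n z)))"
      by (simp only: sum_distrib_left sum_distrib_right)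
    also have "\<dots> = (\<Sum>m=l..n. z powi (w - int r) * (of_nat (n choose l) * of_nat ((n - l) choose (m - l))
          * e ^ m * z powi (int r - int l - int m) * E2 z ^ (n - m) * h n z))"
    proof (rule sum.cong)
      fix m assume "m \<in> {l..n}"
      hence "e ^ m = e ^ l * e ^ (m - l)" by (simp flip: power_add)
      thus "e ^ l * (of_nat (n choose l) * (z powi (w - int r) * (of_nat ((n - l) choose (m - l)) *
          e ^ (m - l) * z powi (int r - int l - int m) * E2 z ^ (n - m)) * h n z)) =
          z powi (w - int r) * (of_nat (n choose l) * of_nat ((n - l) choose (m - l))
          * e ^ m * z powi (int r - int l - int m) * E2 z ^ (n - m) * h n z)"
        by (simp only: mult_ac)
    qed simp
    finally show "e ^ l * (of_nat (n choose l) * (E2 (- 1 / z) ^ (n - l) * h n (- 1 / z))) =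
       (\<Sum>m=l..n. z powi (w - int r) * (of_nat (n choose l) * of_nat ((n - l) choose (m - l))
          * e ^ m * z powi (int r - int l - int m) * E2 z ^ (n - m) * h n z))" .
  qed simp
  also have "(\<Sum>n=l..r. \<Sum>m=l..n. of_nat (n choose l) * of_nat ((n - l) choose (m - l))
     * e ^ m * z powi (int r - int l - int m) * E2 z ^ (n - m) * h n z) =
     (\<Sum>m=l..r. \<Sum>n=m..r. of_nat (n choose l) * of_nat ((n - l) choose (m - l))
     * e ^ m * z powi (int r - int l - int m) * E2 z ^ (n - m) * h n z)"
    by (subst (1 2) sum.Sigma) (auto intro!: sum.reindex_bij_witness[of _ prod.swap prod.swap])
  also have "\<dots> = (\<Sum>m=l..r. of_nat (r choose l) * (slash_coeff r l m z * g m z))"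
  proof (rule sum.cong)
    fix m assume m: "m \<in> {l..r}"
    have "(\<Sum>n=m..r. of_nat (n choose l) * of_nat ((n - l) choose (m - l))
     * e ^ m * z powi (int r - int l - int m) * E2 z ^ (n - m) * h n z) =
     (\<Sum>n=m..r. of_nat (m choose l) * z powi (int r - int l - int m) * (e ^ m * (of_nat (n choose m) * E2 z ^ (n - m) * h n z)))"
    proof (rule sum.cong)
      fix n assume n: "n \<in> {m..r}"
      have "(n choose l) * ((n - l) choose (m - l)) = (n choose m) * (m choose l)"
        using choose_mult[of l m n] m n by simp
      hence "of_nat (n choose l) * of_nat ((n - l) choose (m - l)) = (of_nat (n choose m) * of_nat (m choose l) :: complex)"
        by (metis of_nat_mult)
      thus "of_nat (n choose l) * of_nat ((n - l) choose (m - l))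
        * e ^ m * z powi (int r - int l - int m) * E2 z ^ (n - m) * h n z =
        of_nat (m choose l) * z powi (int r - int l - int m) * (e ^ m * (of_nat (n choose m) * E2 z ^ (n - m) * h n z))"
        by simp
    qed simp
    also have "\<dots> = of_nat (m choose l) * z powi (int r - int l - int m) * (of_nat (r choose m) * g m z)"
      using m by (subst g'[OF _ z]) (simp_all add: sum_distrib_left)
    also have "(r choose l) * ((r - l) choose (m - l)) = (r choose m) * (m choose l)"
      using choose_mult[of l m r] m by simp
    hence "of_nat (m choose l) * of_nat (r choose m) = (of_nat (r choose l) * of_nat ((r - l) choose (m - l)) :: complex)"
      by (metis of_nat_mult mult.commute)
    hence "of_nat (m choose l) * z powi (int r - int l - int m) * (of_nat (r choose m) * g m z) =
           of_nat (r choose l) * (slash_coeff r l m z * g m z)"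
      using m by (simp add: slash_coeff_def)
    finally show "(\<Sum>n=m..r. of_nat (n choose l) * of_nat ((n - l) choose (m - l))
     * e ^ m * z powi (int r - int l - int m) * E2 z ^ (n - m) * h n z) =
           of_nat (r choose l) * (slash_coeff r l m z * g m z)" .
  qed simp
  also have "\<dots> = of_nat (r choose l) * (\<Sum>m=l..r. slash_coeff r l m z * g m z)"
    by (simp add: sum_distrib_left)
  also have "(\<Sum>m=l..r. slash_coeff r l m z * g m z) = (\<Sum>m\<le>r. slash_coeff r l m z * g m z)"
    by (rule sum.mono_neutral_left) (auto simp: slash_coeff_def)
  finally have "of_nat (r choose l) * g l (- 1 / z) =
      of_nat (r choose l) * (z powi (w - int r) * (\<Sum>m\<le>r. slash_coeff r l m z * g m z))"
    by (simp add: mult_ac)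
  thus ?thesis using l by (subst (asm) mult_left_cancel) auto
qed

text \<open>Transfers convergence of the expansions from the half plane to every nonzero point of
  the disc.\<close>

lemma q_param_image:
  assumes "q \<in> ball 0 1" "q \<noteq> 0"
  obtains z where "Im z > 0" "q_param z = q"
proof
  have "Im (Ln q / (2 * of_real pi * \<i>)) = - ln (norm q) / (2 * pi)"
    using assms by (simp add: Im_divide power2_eq_square)
  also have "\<dots> > 0" using assms by (simp add: divide_less_0_iff)
  finally show "Im (Ln q / (2 * of_real pi * \<i>)) > 0" .
  show "q_param (Ln q / (2 * of_real pi * \<i>)) = q"
    using assms by (simp add: q_param_def)
qed

theorem proposition4p1:
  fixes w :: int and r :: nat
    and f :: "complex \<Rightarrow> complex"
    and h g :: "nat \<Rightarrow> complex \<Rightarrow> complex"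
    and lam :: "nat \<Rightarrow> nat"
    and a :: "nat \<Rightarrow> nat \<Rightarrow> complex"
  assumes h: "\<And>l. l \<le> r \<Longrightarrow> h l \<in> modular_forms (w - 2 * int l)"
    and f: "f = (\<lambda>z. \<Sum>l\<le>r. E2 z ^ l * h l z)"
    and depth: "h r \<noteq> (\<lambda>_. 0)"
    and g: "\<And>l z. l \<le> r \<Longrightarrow> z \<in> upper_half_plane \<Longrightarrow>
      of_nat (r choose l) * g l z =
        (6 / (of_real pi * \<i>)) ^ l *
        (\<Sum>m=0..r-l. of_nat ((l + m) choose m) * E2 z ^ m * h (l + m) z)"
    and lam_less: "\<And>l. l \<le> r \<Longrightarrow>
      lam l < complex_fun.dim (quasimodular_forms (w - 2 * int l) (r - l))"
    and lam_decreasing: "\<And>l. l < r \<Longrightarrow> lam (Suc l) \<le> lam l"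
    and lead: "\<And>l. l \<le> r \<Longrightarrow> a l 0 \<noteq> 0"
    and summable: "\<And>l z. l \<le> r \<Longrightarrow> z \<in> upper_half_plane \<Longrightarrow>
      summable (\<lambda>n. a l n * q_param z ^ n)"
    and vanishing: "\<And>l z. l \<le> r \<Longrightarrow> z \<in> upper_half_plane \<Longrightarrow>
      g l z = q_param z ^ lam l * (\<Sum>n. a l n * q_param z ^ n)"
  shows "real (\<Sum>l\<le>r. lam l) \<le> real_of_int w * (real r + 1) / 12"
proof -
  interpret quasimodular_system r w lam "\<lambda>k q. \<Sum>n. a k n * q ^ n" g
  proof
    fix k assume k: "k \<le> r"
    \<comment> \<open>Convergence on the whole open disc makes the q-series holomorphic there,
      including at the cusp q = 0.\<close>
    have "summable (\<lambda>n. a k n * q ^ n)" if "norm q < 1" for q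
    proof (cases "q = 0")
      case False
      with that obtain z where "Im z > 0" "q_param z = q"
        using q_param_image[of q] by auto
      with summable[OF k, of z] show ?thesis by (simp add: upper_half_plane_def)
    qed simp
    hence "((\<lambda>q. \<Sum>n. a k n * q ^ n) has_field_derivative (\<Sum>n. diffs (a k) n * q ^ n)) (at q)"
      if "norm q < 1" for q
      using that by (intro termdiffs_strong'[of 1]) auto
    thus "(\<lambda>q. \<Sum>n. a k n * q ^ n) holomorphic_on ball 0 1"
      unfolding holomorphic_on_open[OF open_ball] by fastforce
    show "(\<Sum>n. a k n * 0 ^ n) \<noteq> 0" using lead[OF k] by (simp add: powser_zero)
  next
    fix k assume "k < r"
    thus "lam (Suc k) \<le> lam k" by (rule lam_decreasing)
  next
    fix k z assume "k \<le> r" "Im z > 0"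
    thus "g k z = q_param z ^ lam k * (\<Sum>n. a k n * q_param z ^ n)"
      by (intro vanishing) (auto simp: upper_half_plane_def)
  next
    fix l z assume "l \<le> r" "Im z > 0"
    thus "g l (- 1 / z) = z powi (w - int r) * (\<Sum>m\<le>r. slash_coeff r l m z * g m z)"
      by (intro quasimodular_slash[of r h] h g) (auto simp: upper_half_plane_def)
  qed
  have "real_of_int (12 * int (\<Sum>k\<le>r. lam k)) \<le> real_of_int (w * (int r + 1))"
    using sum_lam_le by (simp only: of_int_le_iff)
  thus ?thesis by simp
qed

end
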